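(* Let $A$ be a closed, densely defined, dissipative operator on a complex Hilbert space $X$, and assume that there exists $\mu \in \mathbb{C}$ such that $\operatorname{Re}\mu<0$ and $\mu \notin \sigma_{\mathrm{p}}(A)$. Then there exist a Hilbert space $Y \supseteq X$ and an outer extension $B$ of $A$ on $Y$ such that $B$ generates a $C_0$-semigroup of contractions on $Y$.
   Context: An operator $A$ on $X$ is a (possibly unbounded) linear map from a subspace $D(A)\subseteq X$ into $X$. $A$ is dissipative if $\operatorname{Re}\langle Ax,x\rangle\le0$ for all $x\in D(A)$. $\sigma_{\mathrm{p}}(A)$ is the point spectrum (set of eigenvalues) of $A$. $Y\supseteq X$ means that $X$ is a closed subspace of $Y$ with the same norm (up to identification via a linear isometric embedding of $X$ into $Y$). An operator $B$ on $Y\supseteq X$ is an outer extension of $A$ if $D(A)=D(B)\cap X$ and $Bx=Ax$ for all $x\in D(A)$. *)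

theory Defs
  imports "HOL-Analysis.Analysis" "HOL-Algebra.Module"
begin

text \<open>
  The Hilbert space \<open>Y\<close> is existentially quantified, so Hilbert spaces are treated as
  structures with an explicit carrier, on top of the modules of HOL-Algebra. The inherited
  record fields \<open>mult\<close> and \<open>one\<close> are not used, as usual for modules. The elements of \<open>Y\<close> are
  drawn from the type of sequences over the type of \<open>X\<close>. This loses no generality: \<open>Y\<close> can be
  cut down to the closed span of the semigroup orbits of \<open>X\<close>, which is no larger than \<open>X\<close>.
\<close>

record 'a hilbert = "(complex, 'a) module" +
  inner_prod :: "'a \<Rightarrow> 'a \<Rightarrow> complex"

definition complex_field :: "complex ring"
  where "complex_field = \<lparr>carrier = UNIV, mult = (*), one = 1, zero = 0, add = (+)\<rparr>"

definition hnorm :: "'a hilbert \<Rightarrow> 'a \<Rightarrow> real"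
  where "hnorm H x = sqrt (Re (inner_prod H x x))"

text \<open>
  The guard is needed because the library requires metrics to be nonnegative and symmetric
  on the whole type, also outside the carrier.
\<close>

definition hdist :: "'a hilbert \<Rightarrow> 'a \<Rightarrow> 'a \<Rightarrow> real"
  where "hdist H x y =
    (if x \<in> carrier H \<and> y \<in> carrier H then hnorm H (x \<ominus>\<^bsub>H\<^esub> y) else 0)"

definition hmetric :: "'a hilbert \<Rightarrow> 'a metric"
  where "hmetric H = metric (carrier H, hdist H)"

abbreviation htopology :: "'a hilbert \<Rightarrow> 'a topology"
  where "htopology H \<equiv> mtopology_of (hmetric H)"

locale complex_inner_product_space =
  Module.module complex_field H for H :: "'a hilbert" (structure) +
  assumes inner_add_left:
      "\<lbrakk>x \<in> carrier H; y \<in> carrier H; z \<in> carrier H\<rbrakk> \<Longrightarrow>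
        inner_prod H (x \<oplus> y) z = inner_prod H x z + inner_prod H y z"
    and inner_smult_left:
      "\<lbrakk>x \<in> carrier H; y \<in> carrier H\<rbrakk> \<Longrightarrow>
        inner_prod H (c \<odot> x) y = c * inner_prod H x y"
    and inner_commute:
      "\<lbrakk>x \<in> carrier H; y \<in> carrier H\<rbrakk> \<Longrightarrow> inner_prod H y x = cnj (inner_prod H x y)"
    and inner_pos:
      "\<lbrakk>x \<in> carrier H; x \<noteq> \<zero>\<rbrakk> \<Longrightarrow> Re (inner_prod H x x) > 0"

context complex_inner_product_space
begin

lemma inner_nonneg: "x \<in> carrier H \<Longrightarrow> Re (inner_prod H x x) \<ge> 0"
proof (cases "x = \<zero>")
  case True
  then show ?thesis
    using inner_add_left[of \<zero> \<zero> \<zero>] by simp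
qed (use inner_pos in \<open>auto intro: less_imp_le\<close>)

lemma inner_expand:
  fixes t :: real
  assumes x: "x \<in> carrier H" and y: "y \<in> carrier H"
  shows "Re (inner_prod H (x \<oplus> complex_of_real t \<odot> y) (x \<oplus> complex_of_real t \<odot> y)) =
    Re (inner_prod H x x) + 2 * t * Re (inner_prod H x y) + t\<^sup>2 * Re (inner_prod H y y)"
proof -
  define v where "v = complex_of_real t \<odot> y"
  have v: "v \<in> carrier H"
    using y smult_closed[of "complex_of_real t" y] by (simp add: v_def complex_field_def)
  have vl: "inner_prod H v z = t * inner_prod H y z" if "z \<in> carrier H" for z
    using inner_smult_left[OF y that] by (simp add: v_def)
  have 1: "inner_prod H x v = t * inner_prod H x y"
    using inner_commute[OF v x] vl[OF x] inner_commute[OF y x] by simp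
  have 2: "inner_prod H y v = t * inner_prod H y y"
    using inner_commute[OF v y] vl[OF y] inner_commute[OF y y] by simp
  have "inner_prod H (x \<oplus> v) (x \<oplus> v) = inner_prod H x (x \<oplus> v) + inner_prod H v (x \<oplus> v)"
    using x v inner_add_left by simp
  also have "inner_prod H x (x \<oplus> v) = inner_prod H x x + inner_prod H x v"
    using inner_commute[of "x \<oplus> v" x] inner_add_left[OF x v x]
      inner_commute[OF x x] inner_commute[OF v x] x v by simp
  also have "inner_prod H v (x \<oplus> v) = inner_prod H v x + inner_prod H v v"
    using inner_commute[of "x \<oplus> v" v] inner_add_left[OF x v v]
      inner_commute[OF x v] inner_commute[OF v v] x v by simp
  finally show ?thesis
    using inner_commute[OF x y] by (simp add: v_def[symmetric] vl 1 2 v x power2_eq_square)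
qed

lemma hnorm_zero_iff: "x \<in> carrier H \<Longrightarrow> hnorm H x = 0 \<longleftrightarrow> x = \<zero>"
  using inner_pos[of x] inner_add_left[of \<zero> \<zero> \<zero>]
  by (cases "x = \<zero>") (auto simp: hnorm_def)

lemma one_smult: "x \<in> carrier H \<Longrightarrow> 1 \<odot> x = x"
  using smult_one[of x] by (simp add: complex_field_def)

lemma Re_inner_le:
  assumes x: "x \<in> carrier H" and y: "y \<in> carrier H"
  shows "Re (inner_prod H x y) \<le> hnorm H x * hnorm H y"
proof -
  let ?a = "Re (inner_prod H x x)" and ?b = "Re (inner_prod H x y)" and ?c = "Re (inner_prod H y y)"
  have nn: "0 \<le> ?a + 2 * t * ?b + t\<^sup>2 * ?c" for t
    using inner_nonneg[of "x \<oplus> complex_of_real t \<odot> y"] inner_expand[OF x y, of t]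
      x y smult_closed[of "complex_of_real t" y] by (simp add: complex_field_def)
  have "?b\<^sup>2 \<le> ?a * ?c"
  proof (cases "?c = 0")
    case True
    have "?b = 0"
    proof (rule ccontr)
      assume "?b \<noteq> 0"
      with nn[of "- (?a + 1) / (2 * ?b)"] True show False by (simp add: field_simps)
    qed
    then show ?thesis by (simp add: True)
  next
    case False
    then have c: "?c > 0" using inner_nonneg[OF y] by simp
    have "0 \<le> ?a - ?b\<^sup>2 / ?c"
      using nn[of "- ?b / ?c"] c by (simp add: power2_eq_square field_simps)
    then show ?thesis using c by (simp add: field_simps)
  qed
  then have "sqrt (?b\<^sup>2) \<le> sqrt (?a * ?c)" by (rule real_sqrt_le_mono)
  then show ?thesis by (simp add: hnorm_def real_sqrt_mult)
qed

lemma hnorm_add_le: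
  assumes x: "x \<in> carrier H" and y: "y \<in> carrier H"
  shows "hnorm H (x \<oplus> y) \<le> hnorm H x + hnorm H y"
proof (rule power2_le_imp_le)
  show "(hnorm H (x \<oplus> y))\<^sup>2 \<le> (hnorm H x + hnorm H y)\<^sup>2"
    using inner_expand[OF x y, of 1] Re_inner_le[OF x y] inner_nonneg[of "x \<oplus> y"] x y
    by (simp add: one_smult power2_sum inner_nonneg hnorm_def)
  show "0 \<le> hnorm H x + hnorm H y"
    using x y by (simp add: hnorm_def inner_nonneg)
qed

lemma hnorm_minus: "x \<in> carrier H \<Longrightarrow> hnorm H (\<ominus> x) = hnorm H x"
proof -
  assume x: "x \<in> carrier H"
  have "(- 1) \<odot> x \<oplus> 1 \<odot> x = ((- 1) + 1) \<odot> x"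
    using smult_l_distr[of "- 1" 1 x] x by (simp add: complex_field_def)
  also have "\<dots> = \<zero>"
    using smult_l_null[OF x] by (simp add: complex_field_def)
  finally have "\<ominus> x = complex_of_real (- 1) \<odot> x"
    using x smult_closed[of "- 1" x] one_smult[OF x]
    by (simp add: complex_field_def minus_equality)
  then show ?thesis
    using inner_expand[of \<zero> x "- 1"] inner_add_left[of \<zero> \<zero> \<zero>] inner_add_left[of \<zero> \<zero> x] x
      smult_closed[of "- 1" x] by (simp add: hnorm_def complex_field_def)
qed

lemma Metric_space_hdist: "Metric_space (carrier H) (hdist H)"
proof
  show "0 \<le> hdist H x y" for x y
    by (simp add: hdist_def hnorm_def inner_nonneg)
  show "hdist H x y = hdist H y x" for x y
    using hnorm_minus[of "x \<ominus> y"]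
    by (auto simp: hdist_def minus_eq minus_add a_comm)
  show "hdist H x y = 0 \<longleftrightarrow> x = y" if "x \<in> carrier H" "y \<in> carrier H" for x y
  proof -
    have "x = y" if "x \<ominus> y = \<zero>"
      using that \<open>x \<in> carrier H\<close> \<open>y \<in> carrier H\<close> minus_equality[of x "\<ominus> y"]
      by (simp add: minus_eq)
    moreover have "y \<ominus> y = \<zero>"
      using \<open>y \<in> carrier H\<close> by (simp add: minus_eq r_neg)
    ultimately show ?thesis
      using that by (auto simp: hdist_def hnorm_zero_iff)
  qed
  show "hdist H x z \<le> hdist H x y + hdist H y z"
    if "x \<in> carrier H" "y \<in> carrier H" "z \<in> carrier H" for x y z
  proof -
    have "x \<ominus> z = (x \<ominus> y) \<oplus> (y \<ominus> z)"
      using that by (simp add: minus_eq a_assoc r_neg1)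
    then show ?thesis
      using hnorm_add_le[of "x \<ominus> y" "y \<ominus> z"] that by (simp add: hdist_def)
  qed
qed

lemma mspace_hmetric: "mspace (hmetric H) = carrier H"
  by (simp add: hmetric_def Metric_space.mspace_metric[OF Metric_space_hdist])

lemma mdist_hmetric: "mdist (hmetric H) = hdist H"
  by (simp add: hmetric_def Metric_space.mdist_metric[OF Metric_space_hdist])

end

locale complex_hilbert_space = complex_inner_product_space +
  assumes complete: "mcomplete_of (hmetric H)"

text \<open>An operator is given by its domain \<open>D\<close> and a function whose values outside \<open>D\<close> are irrelevant.\<close>

definition linear_operator :: "'a hilbert \<Rightarrow> 'a set \<Rightarrow> ('a \<Rightarrow> 'a) \<Rightarrow> bool"
  where "linear_operator H D A \<longleftrightarrow>
    submodule D complex_field H \<and> A \<in> D \<rightarrow> carrier H \<and>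
    (\<forall>x\<in>D. \<forall>y\<in>D. A (x \<oplus>\<^bsub>H\<^esub> y) = A x \<oplus>\<^bsub>H\<^esub> A y) \<and>
    (\<forall>c. \<forall>x\<in>D. A (c \<odot>\<^bsub>H\<^esub> x) = c \<odot>\<^bsub>H\<^esub> A x)"

definition closed_operator :: "'a hilbert \<Rightarrow> 'a set \<Rightarrow> ('a \<Rightarrow> 'a) \<Rightarrow> bool"
  where "closed_operator H D A \<longleftrightarrow>
    closedin (prod_topology (htopology H) (htopology H)) ((\<lambda>x. (x, A x)) ` D)"

definition densely_defined :: "'a hilbert \<Rightarrow> 'a set \<Rightarrow> bool"
  where "densely_defined H D \<longleftrightarrow> htopology H closure_of D = carrier H"

definition dissipative :: "'a hilbert \<Rightarrow> 'a set \<Rightarrow> ('a \<Rightarrow> 'a) \<Rightarrow> bool"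
  where "dissipative H D A \<longleftrightarrow> (\<forall>x\<in>D. Re (inner_prod H (A x) x) \<le> 0)"

definition point_spectrum :: "'a hilbert \<Rightarrow> 'a set \<Rightarrow> ('a \<Rightarrow> 'a) \<Rightarrow> complex set"
  where "point_spectrum H D A = {\<mu>. \<exists>x\<in>D. x \<noteq> \<zero>\<^bsub>H\<^esub> \<and> A x = \<mu> \<odot>\<^bsub>H\<^esub> x}"

definition isometric_embedding :: "'a hilbert \<Rightarrow> 'b hilbert \<Rightarrow> ('a \<Rightarrow> 'b) \<Rightarrow> bool"
  where "isometric_embedding X Y \<iota> \<longleftrightarrow>
    \<iota> \<in> carrier X \<rightarrow> carrier Y \<and>
    (\<forall>x\<in>carrier X. \<forall>y\<in>carrier X. \<iota> (x \<oplus>\<^bsub>X\<^esub> y) = \<iota> x \<oplus>\<^bsub>Y\<^esub> \<iota> y) \<and>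
    (\<forall>c. \<forall>x\<in>carrier X. \<iota> (c \<odot>\<^bsub>X\<^esub> x) = c \<odot>\<^bsub>Y\<^esub> \<iota> x) \<and>
    (\<forall>x\<in>carrier X. hnorm Y (\<iota> x) = hnorm X x) \<and>
    closedin (htopology Y) (\<iota> ` carrier X)"

text \<open>
  \<open>(DB, B)\<close> on \<open>Y\<close> is an outer extension of \<open>(DA, A)\<close> on \<open>X\<close>, where \<open>X\<close> is identified with
  a closed subspace of \<open>Y\<close> via \<open>\<iota>\<close>.
\<close>

definition outer_extension ::
    "'a hilbert \<Rightarrow> 'a set \<Rightarrow> ('a \<Rightarrow> 'a) \<Rightarrow> ('a \<Rightarrow> 'b) \<Rightarrow> 'b hilbert \<Rightarrow> 'b set \<Rightarrow> ('b \<Rightarrow> 'b) \<Rightarrow> bool"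
  where "outer_extension X DA A \<iota> Y DB B \<longleftrightarrow>
    linear_operator Y DB B \<and>
    \<iota> ` DA = DB \<inter> \<iota> ` carrier X \<and>
    (\<forall>x\<in>DA. B (\<iota> x) = \<iota> (A x))"

definition contraction_semigroup :: "'a hilbert \<Rightarrow> (real \<Rightarrow> 'a \<Rightarrow> 'a) \<Rightarrow> bool"
  where "contraction_semigroup H T \<longleftrightarrow>
    (\<forall>t\<ge>0. linear_operator H (carrier H) (T t)) \<and>
    (\<forall>t\<ge>0. \<forall>x\<in>carrier H. hnorm H (T t x) \<le> hnorm H x) \<and>
    (\<forall>x\<in>carrier H. T 0 x = x) \<and>
    (\<forall>s\<ge>0. \<forall>t\<ge>0. \<forall>x\<in>carrier H. T (s + t) x = T s (T t x)) \<and>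
    (\<forall>x\<in>carrier H. limitin (htopology H) (\<lambda>t. T t x) x (at_right 0))"

text \<open>The domain of the generator consists of all \<open>x\<close> for which the limit exists.\<close>

definition is_generator :: "'a hilbert \<Rightarrow> (real \<Rightarrow> 'a \<Rightarrow> 'a) \<Rightarrow> 'a set \<Rightarrow> ('a \<Rightarrow> 'a) \<Rightarrow> bool"
  where "is_generator H T D B \<longleftrightarrow>
    D = {x \<in> carrier H. \<exists>y. limitin (htopology H)
          (\<lambda>t. complex_of_real (1 / t) \<odot>\<^bsub>H\<^esub> (T t x \<ominus>\<^bsub>H\<^esub> x)) y (at_right 0)} \<and>
    (\<forall>x\<in>D. limitin (htopology H)
          (\<lambda>t. complex_of_real (1 / t) \<odot>\<^bsub>H\<^esub> (T t x \<ominus>\<^bsub>H\<^esub> x)) (B x) (at_right 0))"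

definition generates_contraction_semigroup :: "'a hilbert \<Rightarrow> 'a set \<Rightarrow> ('a \<Rightarrow> 'a) \<Rightarrow> bool"
  where "generates_contraction_semigroup H D B \<longleftrightarrow>
    (\<exists>T. contraction_semigroup H T \<and> is_generator H T D B)"

end

theory Submission
  imports Defs "HOL-Probability.Discrete_Topology"
begin

text \<open>
Let \<open>R\<close> be the range of \<open>I - A\<close>. Dissipativity gives \<open>\<parallel>x\<parallel> \<le> \<parallel>x - A x\<parallel>\<close>, so \<open>R\<close> is closed because \<open>A\<close> is, and the
Cayley transform \<open>x - A x \<mapsto> x + A x\<close> is a contraction from \<open>R\<close> into \<open>X\<close>. What separates \<open>A\<close> from a
generator is the orthogonal complement of \<open>R\<close>. The complement is fed into a unilateral shift: on the
space \<open>l2 X\<close> of square-summable sequences, with \<open>X\<close> embedded as the zeroth coordinate, let \<open>W\<close> act as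
the Cayley transform on \<open>R\<close>, send the component of the zeroth coordinate orthogonal to \<open>R\<close> to the
first coordinate, and move every other coordinate one place to the right. Then \<open>W\<close> is a contraction
on \<open>l2 X\<close>, and the operator with Cayley transform \<open>W\<close> is the required \<open>B\<close>. Written out, with
\<open>push a g = (a, g 0, g 1, ...)\<close>, its domain consists of the sequences \<open>push a g + g\<close> where \<open>a\<close> is in
the domain of \<open>A\<close>, \<open>g\<close> is square-summable and \<open>g 0\<close> is orthogonal to \<open>R\<close>, and
\<open>B (push a g + g) = push (A a) g - g\<close>.

This formula gives all the properties. The pair \<open>(a, g)\<close> is determined by the sequence, since a
difference of two admissible \<open>g\<close> has alternating coordinates of constant norm and is
square-summable, hence zero (\<open>push_add_inject\<close>). The same argument shows that an element of the
domain that lies in \<open>X\<close> has \<open>g = 0\<close>; therefore \<open>B\<close> is an outer extension, and not only an extension.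
The contributions of \<open>g\<close> to \<open>Re \<langle>B y, y\<rangle>\<close> telescope and leave \<open>Re \<langle>A a, a\<rangle>\<close> (\<open>dissipative_dilation\<close>).
Finally \<open>y - B y = (a - A a + 2 g 0, 2 g 1, 2 g 2, ...)\<close>, so the decomposition of a zeroth
coordinate along \<open>R\<close> and its complement shows that \<open>I - B\<close> is onto (\<open>onto_dilation\<close>).

By the Lumer-Phillips theorem (\<open>lumer_phillips\<close>) a dissipative operator with \<open>I - B\<close> onto generates a
contraction semigroup. Its proof here takes the semigroup as the limit of implicit Euler steps
\<open>(I - B / 2^n)^{-k}\<close> with \<open>k / 2^n\<close> close to \<open>t\<close>: halving the step costs an error of the order of the
step on the domain of \<open>B^2\<close>, and all the operators involved are contractions, so that density of
that domain suffices. The limits are taken in a Banach space of bounded functions, into which a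
Hilbert space with an explicit carrier embeds isometrically (\<open>emb\<close>).
\<close>

section \<open>Contraction semigroups from implicit Euler steps\<close>

text \<open>
Step sizes are dyadic so that two steps of one grid make up exactly one step of the previous grid.
\<close>

definition mesh :: "nat \<Rightarrow> real" where "mesh n = 1 / 2 ^ n"

lemma mesh_pos: "0 < mesh n" by (simp add: mesh_def)

lemma mesh_Suc: "mesh (Suc n) = mesh n / 2" by (simp add: mesh_def)

lemma mesh_lim: "mesh \<longlonglongrightarrow> 0"
proof -
  have "(\<lambda>n. (1/2) ^ n :: real) \<longlonglongrightarrow> 0" by (rule LIMSEQ_power_zero) simp
  then show ?thesis by (simp add: mesh_def[abs_def] power_one_over)
qed

lemma floor_bound: "0 \<le> t \<Longrightarrow> real (nat \<lfloor>t * 2 ^ n\<rfloor>) * mesh n \<le> t"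
  by (simp add: mesh_def field_simps)

lemma floor_double:
  assumes "0 \<le> (r::real)"
  shows "nat \<lfloor>2 * r\<rfloor> = 2 * nat \<lfloor>r\<rfloor> \<or> nat \<lfloor>2 * r\<rfloor> = Suc (2 * nat \<lfloor>r\<rfloor>)"
  using assms by linarith

lemma floor_add:
  assumes "0 \<le> (r::real)" "0 \<le> q"
  shows "nat \<lfloor>r + q\<rfloor> = nat \<lfloor>r\<rfloor> + nat \<lfloor>q\<rfloor> \<or> nat \<lfloor>r + q\<rfloor> = Suc (nat \<lfloor>r\<rfloor> + nat \<lfloor>q\<rfloor>)"
  using assms by linarith

lemma floor_tendsto: "0 \<le> t \<Longrightarrow> (\<lambda>n. real (nat \<lfloor>t * 2 ^ n\<rfloor>) * mesh n) \<longlonglongrightarrow> t"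
proof (rule real_tendsto_sandwich)
  assume t: "0 \<le> t"
  show "\<forall>\<^sub>F n in sequentially. t - mesh n \<le> real (nat \<lfloor>t * 2 ^ n\<rfloor>) * mesh n"
  proof (intro always_eventually allI)
    fix n
    have "(t * 2 ^ n - 1) * mesh n \<le> real (nat \<lfloor>t * 2 ^ n\<rfloor>) * mesh n"
      using mesh_pos[of n] by (intro mult_right_mono) linarith+
    moreover have "(t * 2 ^ n - 1) * mesh n = t - mesh n" by (simp add: mesh_def field_simps)
    ultimately show "t - mesh n \<le> real (nat \<lfloor>t * 2 ^ n\<rfloor>) * mesh n" by simp
  qed
  show "\<forall>\<^sub>F n in sequentially. real (nat \<lfloor>t * 2 ^ n\<rfloor>) * mesh n \<le> t"
    using t by (intro always_eventually allI floor_bound)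
  show "(\<lambda>n. t - mesh n) \<longlonglongrightarrow> t" using tendsto_diff[OF tendsto_const mesh_lim, of t] by simp
qed simp

lemma zero_if_small: "(\<And>e. 0 < e \<Longrightarrow> norm (z :: 'e::real_normed_vector) \<le> e) \<Longrightarrow> z = 0"
  by (metis field_le_epsilon add_0 norm_le_zero_iff)

lemma at_right_small:
  assumes "0 < e"
  shows "\<forall>\<^sub>F t in at_right (0::real). t * c < e"
proof -
  have "((\<lambda>t. t * c) \<longlongrightarrow> 0 * c) (at_right 0)" by (intro tendsto_intros)
  then show ?thesis using assms by (intro order_tendstoD(2)[where y = 0]) auto
qed

text \<open>
The domain and the values of the operator lie in a closed subspace \<open>S\<close> of a Banach space type, because
a Hilbert space with an explicit carrier is a subspace, and not a whole type, once it is embedded.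
The inequality \<open>dissip\<close> is the form that dissipativity takes in a normed space.
\<close>

locale maximal_dissipative =
  fixes S D :: "'e::banach set" and B :: "'e \<Rightarrow> 'e"
  assumes subspace_S: "subspace S" and closed_S: "closed S"
    and subspace_D: "subspace D" and D_subset: "D \<subseteq> S" and dense: "S \<subseteq> closure D"
    and B_in: "x \<in> D \<Longrightarrow> B x \<in> S"
    and B_add: "x \<in> D \<Longrightarrow> y \<in> D \<Longrightarrow> B (x + y) = B x + B y"
    and B_scale: "x \<in> D \<Longrightarrow> B (r *\<^sub>R x) = r *\<^sub>R B x"
    and dissip: "0 < h \<Longrightarrow> x \<in> D \<Longrightarrow> norm x \<le> norm (x - h *\<^sub>R B x)"
    and surj_one: "x \<in> S \<Longrightarrow> \<exists>y\<in>D. y - B y = x"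
begin

lemma D_in_S: "x \<in> D \<Longrightarrow> x \<in> S"
  using D_subset by blast

lemmas S_add = subspace_add[OF subspace_S]
  and S_diff = subspace_diff[OF subspace_S]
  and S_scale = subspace_scale[OF subspace_S]
  and D_diff = subspace_diff[OF subspace_D]
  and D_scale = subspace_scale[OF subspace_D]

lemma B_diff: "x \<in> D \<Longrightarrow> y \<in> D \<Longrightarrow> B (x - y) = B x - B y"
  using B_add[of x "(-1) *\<^sub>R y"] B_scale[of y "-1"] D_scale[of y "-1"] by simp

lemma solution_unique:
  assumes "0 < h" "y \<in> D" "z \<in> D" "y - h *\<^sub>R B y = z - h *\<^sub>R B z"
  shows "y = z"
proof -
  have "norm (y - z) \<le> norm ((y - z) - h *\<^sub>R B (y - z))"
    using assms by (intro dissip D_diff)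
  also have "(y - z) - h *\<^sub>R B (y - z) = (y - h *\<^sub>R B y) - (z - h *\<^sub>R B z)"
    using assms by (simp add: B_diff algebra_simps)
  finally show ?thesis using assms by simp
qed

definition onto :: "real \<Rightarrow> bool"
  where "onto h \<longleftrightarrow> (\<forall>x\<in>S. \<exists>y\<in>D. y - h *\<^sub>R B y = x)"

definition resolvent :: "real \<Rightarrow> 'e \<Rightarrow> 'e"
  where "resolvent h x = (SOME y. y \<in> D \<and> y - h *\<^sub>R B y = x)"

lemma resolvent_solves:
  assumes "onto h" "x \<in> S"
  shows "resolvent h x \<in> D" "resolvent h x - h *\<^sub>R B (resolvent h x) = x"
proof -
  have "\<exists>y. y \<in> D \<and> y - h *\<^sub>R B y = x"
    using assms unfolding onto_def by blast
  from someI_ex[OF this] show "resolvent h x \<in> D" "resolvent h x - h *\<^sub>R B (resolvent h x) = x"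
    unfolding resolvent_def by auto
qed

lemma resolvent_nonexpansive:
  assumes "onto h" "0 < h" "x \<in> S" "y \<in> S"
  shows "norm (resolvent h x - resolvent h y) \<le> norm (x - y)"
proof -
  note Jx = resolvent_solves[OF assms(1,3)] and Jy = resolvent_solves[OF assms(1,4)]
  have "norm (resolvent h x - resolvent h y) \<le> norm ((resolvent h x - resolvent h y) - h *\<^sub>R B (resolvent h x - resolvent h y))"
    using Jx Jy assms by (intro dissip D_diff)
  also have "(resolvent h x - resolvent h y) - h *\<^sub>R B (resolvent h x - resolvent h y) =
      (resolvent h x - h *\<^sub>R B (resolvent h x)) - (resolvent h y - h *\<^sub>R B (resolvent h y))"
    using Jx Jy by (simp add: B_diff algebra_simps)
  finally show ?thesis using Jx Jy by simp
qed

text \<open>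
The equation \<open>y - k B y = x\<close> says that \<open>y\<close> is a fixed point of
\<open>y \<mapsto> (I - h B)^{-1} (c x + (1 - c) y)\<close> with \<open>c = h / k\<close>. This map contracts by the factor \<open>c - 1\<close>, which
is less than 1 exactly when \<open>h < 2 k\<close>.
\<close>

lemma onto_step:
  assumes "onto h" "0 < h" "0 < k" "k < h" "h < 2 * k"
  shows "onto k"
  unfolding onto_def
proof
  fix x assume x: "x \<in> S"
  define c where "c = h / k"
  have c: "1 < c" "c < 2" and ck: "c * k = h"
    using assms by (auto simp: c_def field_simps)
  define f where "f = (\<lambda>y. resolvent h (c *\<^sub>R x + (1 - c) *\<^sub>R y))"
  have arg: "c *\<^sub>R x + (1 - c) *\<^sub>R y \<in> S" if "y \<in> S" for y
    using that x by (intro S_add S_scale)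
  have "\<exists>!y. y \<in> S \<and> f y = y"
  proof (rule Banach_fix[where c = "c - 1"])
    show "complete S" using closed_S by (simp add: complete_eq_closed)
    show "S \<noteq> {}" using x by auto
    show "f ` S \<subseteq> S" using resolvent_solves(1)[OF assms(1) arg] D_in_S by (auto simp: f_def)
    show "dist (f y) (f z) \<le> (c - 1) * dist y z" if "y \<in> S" "z \<in> S" for y z
    proof -
      have "dist (f y) (f z) \<le>
          norm ((c *\<^sub>R x + (1 - c) *\<^sub>R y) - (c *\<^sub>R x + (1 - c) *\<^sub>R z))"
        unfolding f_def dist_norm using assms that by (intro resolvent_nonexpansive arg)
      also have "\<dots> = norm ((1 - c) *\<^sub>R (y - z))" by (simp add: algebra_simps)
      also have "\<dots> = (c - 1) * dist y z" using c by (simp add: dist_norm)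
      finally show ?thesis .
    qed
  qed (use c in auto)
  then obtain y where y: "y \<in> S" "f y = y" by blast
  have "y \<in> D" and "y - h *\<^sub>R B y = c *\<^sub>R x + (1 - c) *\<^sub>R y"
    using resolvent_solves[OF assms(1) arg[OF y(1)]] y(2) unfolding f_def by auto
  then have "c *\<^sub>R (y - k *\<^sub>R B y) = c *\<^sub>R x"
    by (simp add: algebra_simps ck)
  then have "y - k *\<^sub>R B y = x" using c by simp
  then show "\<exists>y\<in>D. y - k *\<^sub>R B y = x" using \<open>y \<in> D\<close> by blast
qed

lemma onto_half:
  assumes "onto h" "0 < h" shows "onto (h / 2)"
proof -
  \<comment> \<open>A direct step from \<open>h\<close> to \<open>h / 2\<close> would have contraction factor 1.\<close>
  have "onto (2 * h / 3)" using assms by (intro onto_step[OF assms]) auto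
  then show ?thesis using assms by (rule_tac onto_step[of "2 * h / 3"]) auto
qed

lemma onto_mesh: "onto (mesh n)"
proof (induction n)
  case 0
  then show ?case using surj_one by (simp add: mesh_def onto_def)
next
  case (Suc n)
  then show ?case using onto_half[OF Suc mesh_pos] by (simp add: mesh_Suc)
qed

definition step :: "nat \<Rightarrow> 'e \<Rightarrow> 'e" where "step n = resolvent (mesh n)"

lemma step_in_D: "x \<in> S \<Longrightarrow> step n x \<in> D"
  and step_eq: "x \<in> S \<Longrightarrow> step n x - mesh n *\<^sub>R B (step n x) = x"
  and step_in_S: "x \<in> S \<Longrightarrow> step n x \<in> S"
  using resolvent_solves[OF onto_mesh] D_in_S by (auto simp: step_def)

lemma step_unique: "y \<in> D \<Longrightarrow> y - mesh n *\<^sub>R B y = x \<Longrightarrow> step n x = y"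
  using solution_unique[OF mesh_pos, of "step n x" y n] step_in_D step_eq
  by (metis B_in D_in_S S_diff S_scale)

lemma step_diff:
  assumes "x \<in> S" "y \<in> S"
  shows "step n (x - y) = step n x - step n y"
proof (rule step_unique)
  show "step n x - step n y \<in> D" using assms by (intro D_diff step_in_D)
  have "(step n x - step n y) - mesh n *\<^sub>R B (step n x - step n y) =
      (step n x - mesh n *\<^sub>R B (step n x)) - (step n y - mesh n *\<^sub>R B (step n y))"
    using assms by (simp add: B_diff step_in_D scaleR_diff_right)
  then show "(step n x - step n y) - mesh n *\<^sub>R B (step n x - step n y) = x - y"
    by (simp add: step_eq assms)
qed

lemma step_contraction: "x \<in> S \<Longrightarrow> norm (step n x) \<le> norm x"
  using dissip[OF mesh_pos[of n] step_in_D[of x n]] step_eq[of x n] by simp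

lemma step_B:
  assumes "x \<in> D"
  shows "B (step n x) = step n (B x)" "B (step n x) \<in> D"
proof -
  define y where "y = step n x"
  have y: "y \<in> D" "y - mesh n *\<^sub>R B y = x"
    using assms step_in_D step_eq D_in_S by (auto simp: y_def)
  then have "mesh n *\<^sub>R B y = y - x" by (auto simp: algebra_simps)
  then have By: "B y = (1 / mesh n) *\<^sub>R (y - x)"
    using mesh_pos[of n] by (simp flip: \<open>mesh n *\<^sub>R B y = y - x\<close>)
  then have "B y \<in> D" using y assms by (simp add: D_scale D_diff)
  moreover have "B y - mesh n *\<^sub>R B (B y) = B x"
    using y B_diff[of y "mesh n *\<^sub>R B y"] B_scale[of "B y" "mesh n"] \<open>B y \<in> D\<close> D_scale by simp
  ultimately show "B (step n x) = step n (B x)" "B (step n x) \<in> D"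
    using step_unique[of "B y" n "B x"] by (simp_all add: y_def)
qed

lemma step_displacement: "x \<in> D \<Longrightarrow> norm (step n x - x) \<le> mesh n * norm (B x)"
proof -
  assume x: "x \<in> D"
  have "step n x - x = mesh n *\<^sub>R step n (B x)"
    using step_eq[OF D_in_S[OF x], of n] step_B[OF x] by (simp add: algebra_simps)
  then show ?thesis
    using step_contraction[OF B_in[OF x], of n] mesh_pos[of n] by (simp add: mult_left_mono)
qed

lemma steps_in_S: "x \<in> S \<Longrightarrow> (step n ^^ k) x \<in> S"
  by (induction k) (auto intro: step_in_S)

lemma steps_in_D: "x \<in> D \<Longrightarrow> (step n ^^ k) x \<in> D"
  by (induction k) (auto intro: step_in_D D_in_S)

lemma steps_diff: "x \<in> S \<Longrightarrow> y \<in> S \<Longrightarrow> (step n ^^ k) (x - y) = (step n ^^ k) x - (step n ^^ k) y"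
  by (induction k) (auto simp: step_diff steps_in_S)

lemma steps_contraction: "x \<in> S \<Longrightarrow> norm ((step n ^^ k) x) \<le> norm x"
  by (induction k) (auto intro: order_trans[OF step_contraction] steps_in_S)

lemma steps_B: "x \<in> D \<Longrightarrow> B ((step n ^^ k) x) = (step n ^^ k) (B x)"
  by (induction k) (auto simp: step_B steps_in_D)

lemma steps_move_dom:
  assumes "x \<in> D"
  shows "norm ((step n ^^ k) x - x) \<le> k * mesh n * norm (B x)"
proof (induction k)
  case (Suc k)
  have "norm ((step n ^^ Suc k) x - x) \<le>
      norm (step n ((step n ^^ k) x) - (step n ^^ k) x) + norm ((step n ^^ k) x - x)"
    using norm_triangle_ineq[of "step n ((step n ^^ k) x) - (step n ^^ k) x" "(step n ^^ k) x - x"] by simp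
  also have "norm (step n ((step n ^^ k) x) - (step n ^^ k) x) \<le> mesh n * norm (B x)"
  proof (rule order_trans[OF step_displacement[OF steps_in_D[OF assms]]])
    show "mesh n * norm (B ((step n ^^ k) x)) \<le> mesh n * norm (B x)"
      using steps_contraction[OF B_in[OF assms]] mesh_pos[of n]
      by (simp add: steps_B[OF assms])
  qed
  finally show ?case using Suc by (simp add: algebra_simps)
qed simp

text \<open>
With \<open>d = mesh (Suc n)\<close>, the identity \<open>(I - d B)^2 = (I - 2 d B) + d^2 B^2\<close> shows that two half steps and
one full step differ by the full step applied to \<open>d^2 B^2\<close> of the result. This second order error is
what makes the dyadic approximations a Cauchy sequence.
\<close>

lemma step_twice:
  assumes "x \<in> D" "B x \<in> D"
  shows "norm (step (Suc n) (step (Suc n) x) - step n x) \<le> (mesh (Suc n))\<^sup>2 * norm (B (B x))"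
proof -
  define d where "d = mesh (Suc n)"
  have d: "0 < d" "mesh n = 2 * d" using mesh_pos by (simp_all add: d_def mesh_Suc)
  define z where "z = step (Suc n) (step (Suc n) x)"
  have xS: "x \<in> S" and zD: "z \<in> D" using assms D_in_S step_in_S step_in_D by (auto simp: z_def)
  have Bz: "B z = step (Suc n) (step (Suc n) (B x))"
    using assms D_in_S by (simp add: z_def step_B step_in_D)
  then have BzD: "B z \<in> D" using assms D_in_S by (simp add: step_in_D step_in_S)
  have BBz: "B (B z) = step (Suc n) (step (Suc n) (B (B x)))"
    using assms D_in_S unfolding Bz by (simp add: step_B step_in_D)
  have 1: "z - d *\<^sub>R B z = step (Suc n) x"
    using xS unfolding z_def d_def by (intro step_eq step_in_S)
  have "step (Suc n) x - d *\<^sub>R B (step (Suc n) x) = x"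
    using xS unfolding d_def by (intro step_eq)
  then have 2: "z - (2 * d) *\<^sub>R B z + d\<^sup>2 *\<^sub>R B (B z) = x"
    unfolding 1[symmetric] using zD BzD
    by (simp add: B_diff B_scale D_scale algebra_simps power2_eq_square flip: scaleR_2)
  have BBzS: "B (B z) \<in> S" using BzD B_in by simp
  have "step n (x - d\<^sup>2 *\<^sub>R B (B z)) = z"
    using zD 2 by (intro step_unique) (auto simp: d algebra_simps)
  then have "z - step n x = - step n (d\<^sup>2 *\<^sub>R B (B z))"
    using step_diff[OF xS S_scale[OF BBzS], of n "d\<^sup>2"] by (simp add: algebra_simps)
  then have "norm (z - step n x) \<le> norm (d\<^sup>2 *\<^sub>R B (B z))"
    using step_contraction[OF S_scale[OF BBzS, of "d\<^sup>2"], of n] by simp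
  also have "norm (B (B z)) \<le> norm (B (B x))"
    unfolding BBz using assms B_in
    by (meson step_contraction step_in_S order_trans)
  then have "norm (d\<^sup>2 *\<^sub>R B (B z)) \<le> d\<^sup>2 * norm (B (B x))" by (simp add: mult_left_mono)
  finally show ?thesis by (simp add: z_def d_def)
qed

lemma steps_twice:
  assumes "x \<in> D" "B x \<in> D"
  shows "norm ((step (Suc n) ^^ (2 * k)) x - (step n ^^ k) x) \<le> k * (mesh (Suc n))\<^sup>2 * norm (B (B x))"
proof (induction k)
  case (Suc k)
  define p where "p = (step (Suc n) ^^ (2 * k)) x"
  define q where "q = (step n ^^ k) x"
  have xS: "x \<in> S" using assms D_in_S by simp
  have pS: "p \<in> S" and pD: "p \<in> D" and qS: "q \<in> S"
    using xS assms steps_in_S steps_in_D by (auto simp: p_def q_def)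
  have "(step (Suc n) ^^ (2 * Suc k)) x - (step n ^^ Suc k) x =
      (step (Suc n) (step (Suc n) p) - step n p) + (step n p - step n q)"
    by (simp add: p_def q_def)
  also have "norm \<dots> \<le> norm (step (Suc n) (step (Suc n) p) - step n p) + norm (step n p - step n q)"
    by (rule norm_triangle_ineq)
  also have "norm (step n p - step n q) \<le> norm (p - q)"
    using step_contraction[OF S_diff[OF pS qS]] step_diff[OF pS qS] by simp
  also have "norm (step (Suc n) (step (Suc n) p) - step n p) \<le> (mesh (Suc n))\<^sup>2 * norm (B (B p))"
    using assms pD by (intro step_twice) (auto simp: p_def steps_B steps_in_D)
  also have "norm (B (B p)) \<le> norm (B (B x))"
    using assms by (simp add: p_def steps_B steps_contraction B_in)
  finally have "norm ((step (Suc n) ^^ (2 * Suc k)) x - (step n ^^ Suc k) x) \<le>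
      (mesh (Suc n))\<^sup>2 * norm (B (B x)) + norm (p - q)"
    by (simp add: mult_left_mono)
  with Suc show ?case by (simp add: p_def q_def distrib_right)
qed simp

text \<open>
Implicit Euler approximation at time \<open>t\<close>: as many steps of size \<open>mesh n\<close> as fit into \<open>t\<close>.
\<close>

definition approx :: "nat \<Rightarrow> real \<Rightarrow> 'e \<Rightarrow> 'e"
  where "approx n t = step n ^^ nat \<lfloor>t * 2 ^ n\<rfloor>"

definition flow :: "real \<Rightarrow> 'e \<Rightarrow> 'e"
  where "flow t x = lim (\<lambda>n. approx n t x)"

text \<open>
The finer grid needs twice as many steps, and possibly one more to reach \<open>t\<close>. The former costs
\<open>step_twice\<close> once per coarse step, about \<open>t * 2^n\<close> times; the latter costs one
application of \<open>step_displacement\<close>.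
\<close>

lemma approx_refine:
  assumes "x \<in> D" "B x \<in> D" "0 \<le> t"
  shows "norm (approx (Suc n) t x - approx n t x) \<le> (norm (B x) + t * norm (B (B x))) * (1/2) ^ n"
proof -
  define k where "k = nat \<lfloor>t * 2 ^ n\<rfloor>"
  define l where "l = nat \<lfloor>t * 2 ^ Suc n\<rfloor>"
  define d where "d = mesh (Suc n)"
  have l: "l = 2 * k \<or> l = Suc (2 * k)"
    using floor_double[of "t * 2 ^ n"] assms by (simp add: k_def l_def mult.left_commute)
  have d: "0 < d" "mesh n = 2 * d" using mesh_pos by (simp_all add: d_def mesh_Suc)
  have kd: "k * mesh n \<le> t" unfolding k_def using assms by (intro floor_bound)
  define p where "p = (step (Suc n) ^^ (2 * k)) x"
  have pD: "p \<in> D" using assms steps_in_D by (simp add: p_def)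
  have "norm (step (Suc n) p - p) \<le> d * norm (B x)"
  proof -
    have "norm (step (Suc n) p - p) \<le> d * norm (B p)" unfolding d_def by (rule step_displacement[OF pD])
    also have "norm (B p) \<le> norm (B x)"
      using assms by (simp add: p_def steps_B steps_contraction B_in)
    finally show ?thesis using d by simp
  qed
  then have 1: "norm ((step (Suc n) ^^ l) x - p) \<le> d * norm (B x)"
    using l d by (auto simp: p_def)
  have "norm ((step (Suc n) ^^ l) x - (step n ^^ k) x) \<le>
      norm ((step (Suc n) ^^ l) x - p) + norm (p - (step n ^^ k) x)"
    using norm_triangle_ineq[of "(step (Suc n) ^^ l) x - p" "p - (step n ^^ k) x"] by simp
  also have "\<dots> \<le> d * norm (B x) + k * d\<^sup>2 * norm (B (B x))"
    using 1 steps_twice[OF assms(1,2), of k n] by (simp add: p_def d_def)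
  also have "k * d\<^sup>2 = (k * mesh n) * (d / 2)" by (simp add: d power2_eq_square)
  also have "(k * mesh n) * (d / 2) * norm (B (B x)) \<le> t * (2 * d) * norm (B (B x))"
    using kd d assms by (intro mult_right_mono mult_mono) auto
  also have "d * norm (B x) \<le> (2 * d) * norm (B x)" using d by (intro mult_right_mono) auto
  finally have "norm ((step (Suc n) ^^ l) x - (step n ^^ k) x) \<le>
      (norm (B x) + t * norm (B (B x))) * (2 * d)"
    by (simp add: algebra_simps)
  moreover have "(1/2) ^ n = 2 * d" using d(2) by (simp add: mesh_def power_one_over)
  ultimately show ?thesis by (simp add: approx_def k_def l_def)
qed

lemma approx_in_S: "x \<in> S \<Longrightarrow> approx n t x \<in> S"
  and approx_diff: "x \<in> S \<Longrightarrow> y \<in> S \<Longrightarrow> approx n t (x - y) = approx n t x - approx n t y"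
  and approx_contraction: "x \<in> S \<Longrightarrow> norm (approx n t x) \<le> norm x"
  by (auto simp: approx_def steps_in_S steps_diff steps_contraction)

lemma approx_dist: "x \<in> S \<Longrightarrow> y \<in> S \<Longrightarrow> norm (approx n t x - approx n t y) \<le> norm (x - y)"
  using approx_contraction[OF S_diff] by (simp add: approx_diff)

lemma approx_convergent_smooth:
  assumes "x \<in> D" "B x \<in> D" "0 \<le> t"
  shows "convergent (\<lambda>n. approx n t x)"
proof -
  define X where "X = (\<lambda>n. approx n t x)"
  have "summable (\<lambda>n. (norm (B x) + t * norm (B (B x))) * (1/2) ^ n)"
    by (intro summable_mult summable_geometric) simp
  then have "summable (\<lambda>n. X (Suc n) - X n)"
    unfolding X_def using approx_refine[OF assms] by (rule summable_comparison_test')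
  then obtain s where "(\<lambda>m. \<Sum>n<m. X (Suc n) - X n) \<longlonglongrightarrow> s"
    unfolding summable_def sums_def by blast
  then have "(\<lambda>m. X m - X 0) \<longlonglongrightarrow> s"
    by (simp only: sum_lessThan_telescope)
  then have "(\<lambda>m. (X m - X 0) + X 0) \<longlonglongrightarrow> s + X 0" by (intro tendsto_add tendsto_const)
  then show ?thesis unfolding X_def[symmetric] convergent_def by auto
qed

lemma D_approx: "x \<in> S \<Longrightarrow> 0 < e \<Longrightarrow> \<exists>y\<in>D. norm (x - y) < e"
  using dense closure_approachable[of x D] by (auto simp: dist_norm norm_minus_commute)

lemma step_tendsto:
  assumes "x \<in> S" shows "(\<lambda>n. step n x) \<longlonglongrightarrow> x"
proof (rule LIMSEQ_I)
  fix e :: real assume e: "0 < e"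
  obtain y where y: "y \<in> D" "norm (x - y) < e / 4" using D_approx[OF assms, of "e/4"] e by auto
  have "(\<lambda>n. mesh n * norm (B y)) \<longlonglongrightarrow> 0 * norm (B y)" by (intro tendsto_mult mesh_lim tendsto_const)
  then have "\<forall>\<^sub>F n in sequentially. mesh n * norm (B y) < e / 4"
    using e by (intro order_tendstoD(2)[where y = 0]) auto
  then obtain N where N: "\<And>n. n \<ge> N \<Longrightarrow> mesh n * norm (B y) < e / 4"
    by (auto simp: eventually_sequentially)
  show "\<exists>N. \<forall>n\<ge>N. norm (step n x - x) < e"
  proof (intro exI allI impI)
    fix n assume "n \<ge> N"
    have yS: "y \<in> S" using y D_in_S by simp
    have "step n x - x = step n (x - y) + (step n y - y) - (x - y)"
      using step_diff[OF assms yS] by simp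
    also have "norm \<dots> \<le> norm (step n (x - y)) + norm (step n y - y) + norm (x - y)"
      by (meson norm_triangle_ineq norm_triangle_ineq4 add_mono order_trans order_refl)
    also have "\<dots> < e"
      using step_contraction[OF S_diff[OF assms yS], of n] step_displacement[OF y(1), of n] N[OF \<open>n \<ge> N\<close>] y(2) e
      by linarith
    finally show "norm (step n x - x) < e" .
  qed
qed

lemma D2_approx:
  assumes "x \<in> S" "0 < e"
  shows "\<exists>y\<in>D. B y \<in> D \<and> norm (x - y) < e"
proof -
  obtain y where y: "y \<in> D" "norm (x - y) < e / 2" using D_approx[OF assms(1), of "e/2"] assms by auto
  have "\<forall>\<^sub>F n in sequentially. dist (step n y) y < e / 2"
    using assms by (intro tendstoD[OF step_tendsto[OF D_in_S[OF y(1)]]]) simp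
  then obtain n where "norm (y - step n y) < e / 2"
    by (auto simp: eventually_sequentially dist_norm norm_minus_commute)
  then have "norm (x - step n y) < e"
    using y(2) norm_triangle_ineq[of "x - y" "y - step n y"] by simp
  then show ?thesis using y step_B step_in_D D_in_S by blast
qed

lemma approx_convergent:
  assumes "x \<in> S" "0 \<le> t"
  shows "convergent (\<lambda>n. approx n t x)"
proof -
  have "Cauchy (\<lambda>n. approx n t x)"
  proof (rule CauchyI)
    fix e :: real assume e: "0 < e"
    obtain y where y: "y \<in> D" "B y \<in> D" "norm (x - y) < e / 4"
      using D2_approx[OF assms(1), of "e/4"] e by auto
    have yS: "y \<in> S" using y D_in_S by simp
    have "Cauchy (\<lambda>n. approx n t y)"
      using approx_convergent_smooth[OF y(1,2) assms(2)] by (simp add: Cauchy_convergent_iff)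
    from CauchyD[OF this, of "e/4"] e obtain M where
      M: "\<And>m n. m \<ge> M \<Longrightarrow> n \<ge> M \<Longrightarrow> norm (approx m t y - approx n t y) < e / 4" by auto
    show "\<exists>M. \<forall>m\<ge>M. \<forall>n\<ge>M. norm (approx m t x - approx n t x) < e"
    proof (intro exI allI impI)
      fix m n assume mn: "m \<ge> M" "n \<ge> M"
      have "approx m t x - approx n t x =
          (approx m t x - approx m t y) + (approx m t y - approx n t y) - (approx n t x - approx n t y)" by simp
      also have "norm \<dots> \<le> norm (approx m t x - approx m t y) + norm (approx m t y - approx n t y)
          + norm (approx n t x - approx n t y)"
        by (meson norm_triangle_ineq norm_triangle_ineq4 add_mono order_trans order_refl)
      also have "\<dots> < e"
        using M[OF mn] y(3) approx_dist[OF assms(1) yS, of m t] approx_dist[OF assms(1) yS, of n t] e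
        by linarith
      finally show "norm (approx m t x - approx n t x) < e" .
    qed
  qed
  then show ?thesis by (simp add: Cauchy_convergent_iff)
qed

lemma approx_tendsto: "x \<in> S \<Longrightarrow> 0 \<le> t \<Longrightarrow> (\<lambda>n. approx n t x) \<longlonglongrightarrow> flow t x"
  unfolding flow_def using approx_convergent by (simp add: convergent_LIMSEQ_iff)

lemma flow_in_S:
  assumes "x \<in> S" "0 \<le> t" shows "flow t x \<in> S"
  using closed_sequentially[OF closed_S _ approx_tendsto[OF assms]] approx_in_S[OF assms(1)] by blast

lemma flow_contraction:
  assumes "x \<in> S" "0 \<le> t" shows "norm (flow t x) \<le> norm x"
  by (rule tendsto_upperbound[OF tendsto_norm[OF approx_tendsto[OF assms]]])
     (auto simp: approx_contraction assms)

lemma flow_0: "x \<in> S \<Longrightarrow> flow 0 x = x"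
  by (simp add: flow_def approx_def)

lemma flow_diff:
  assumes "x \<in> S" "y \<in> S" "0 \<le> t" shows "flow t (x - y) = flow t x - flow t y"
proof (rule LIMSEQ_unique)
  show "(\<lambda>n. approx n t (x - y)) \<longlonglongrightarrow> flow t (x - y)" by (intro approx_tendsto S_diff assms)
  show "(\<lambda>n. approx n t (x - y)) \<longlonglongrightarrow> flow t x - flow t y"
    using assms by (simp add: approx_diff tendsto_diff approx_tendsto)
qed

text \<open>
The floors in \<open>approx\<close> are additive up to one step, and one step moves a vector of the domain by
\<open>mesh n * norm (B x)\<close> at most.
\<close>

lemma flow_law_dom:
  assumes "x \<in> D" "0 \<le> s" "0 \<le> t"
  shows "flow (s + t) x = flow s (flow t x)"
proof -
  have xS: "x \<in> S" using assms D_in_S by simp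
  have bound: "norm (approx n (s + t) x - approx n s (approx n t x)) \<le> mesh n * norm (B x)" for n
  proof -
    define k where "k = nat \<lfloor>s * 2 ^ n\<rfloor> + nat \<lfloor>t * 2 ^ n\<rfloor>"
    define p where "p = (step n ^^ k) x"
    have 1: "approx n s (approx n t x) = p" by (simp add: approx_def p_def k_def funpow_add)
    have "nat \<lfloor>(s + t) * 2 ^ n\<rfloor> = k \<or> nat \<lfloor>(s + t) * 2 ^ n\<rfloor> = Suc k"
      unfolding k_def distrib_right using assms by (intro floor_add) auto
    then have "approx n (s + t) x = p \<or> approx n (s + t) x = step n p"
      by (auto simp: approx_def p_def)
    moreover have "norm (step n p - p) \<le> mesh n * norm (B x)"
    proof (rule order_trans[OF step_displacement])
      show "p \<in> D" using assms steps_in_D by (simp add: p_def)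
      show "mesh n * norm (B p) \<le> mesh n * norm (B x)"
        using assms mesh_pos[of n] by (simp add: p_def steps_B steps_contraction B_in)
    qed
    ultimately show ?thesis using mesh_pos[of n] unfolding 1 by auto
  qed
  have "(\<lambda>n. mesh n * norm (B x)) \<longlonglongrightarrow> 0"
    using tendsto_mult[OF mesh_lim tendsto_const, of "norm (B x)"] by simp
  then have "(\<lambda>n. approx n (s + t) x - approx n s (approx n t x)) \<longlonglongrightarrow> 0"
    by (rule Lim_null_comparison[rotated]) (simp add: bound)
  moreover have "(\<lambda>n. approx n s (approx n t x) - approx n s (flow t x)) \<longlonglongrightarrow> 0"
  proof (rule Lim_null_comparison)
    show "\<forall>\<^sub>F n in sequentially. norm (approx n s (approx n t x) - approx n s (flow t x)) \<le> norm (approx n t x - flow t x)"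
      by (intro always_eventually allI approx_dist approx_in_S flow_in_S xS assms)
    show "(\<lambda>n. norm (approx n t x - flow t x)) \<longlonglongrightarrow> 0"
      using approx_tendsto[OF xS assms(3)] by (simp add: LIM_zero tendsto_norm_zero)
  qed
  moreover have "(\<lambda>n. approx n s (flow t x)) \<longlonglongrightarrow> flow s (flow t x)"
    by (intro approx_tendsto flow_in_S xS assms)
  ultimately have "(\<lambda>n. (approx n (s + t) x - approx n s (approx n t x)) +
      (approx n s (approx n t x) - approx n s (flow t x)) + approx n s (flow t x)) \<longlonglongrightarrow> 0 + 0 + flow s (flow t x)"
    by (intro tendsto_add)
  then have "(\<lambda>n. approx n (s + t) x) \<longlonglongrightarrow> flow s (flow t x)" by simp
  moreover have "(\<lambda>n. approx n (s + t) x) \<longlonglongrightarrow> flow (s + t) x"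
    using assms by (intro approx_tendsto xS) auto
  ultimately show ?thesis by (rule LIMSEQ_unique[rotated])
qed

lemma flow_law:
  assumes "x \<in> S" "0 \<le> s" "0 \<le> t"
  shows "flow (s + t) x = flow s (flow t x)"
proof -
  have "flow (s + t) x - flow s (flow t x) = 0"
  proof (rule zero_if_small)
    fix e :: real assume "0 < e"
    then obtain y where y: "y \<in> D" "norm (x - y) < e / 2" using D_approx[OF assms(1), of "e/2"] by auto
    have yS: "y \<in> S" using y D_in_S by simp
    have xy: "x - y \<in> S" using assms yS by (intro S_diff)
    have "flow (s + t) x - flow s (flow t x) = flow (s + t) (x - y) - flow s (flow t (x - y))"
      using assms yS by (simp add: flow_diff flow_in_S flow_law_dom[OF y(1)])
    also have "norm \<dots> \<le> norm (flow (s + t) (x - y)) + norm (flow s (flow t (x - y)))"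
      by (rule norm_triangle_ineq4)
    also have "\<dots> \<le> norm (x - y) + norm (x - y)"
      using assms xy by (intro add_mono flow_contraction order_trans[OF flow_contraction] flow_in_S) auto
    finally show "norm (flow (s + t) x - flow s (flow t x)) \<le> e" using y(2) by simp
  qed
  then show ?thesis by simp
qed

text \<open>
The vector \<open>z\<close> is meant to be an approximation of \<open>x\<close> from the domain, for which the displacement is
linear in time.
\<close>

lemma steps_move:
  assumes "x \<in> S" "z \<in> D"
  shows "norm ((step n ^^ k) x - x) \<le> k * mesh n * norm (B z) + 2 * norm (x - z)"
proof -
  have zS: "z \<in> S" using assms D_in_S by simp
  have "(step n ^^ k) x - x = (step n ^^ k) (x - z) + ((step n ^^ k) z - z) - (x - z)"
    using steps_diff[OF assms(1) zS] by simp
  also have "norm \<dots> \<le> norm ((step n ^^ k) (x - z)) + norm ((step n ^^ k) z - z) + norm (x - z)"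
    by (meson norm_triangle_ineq norm_triangle_ineq4 add_mono order_trans order_refl)
  finally show ?thesis
    using steps_contraction[OF S_diff[OF assms(1) zS], of k n] steps_move_dom[OF assms(2), of k n] by linarith
qed

lemma flow_move:
  assumes "x \<in> S" "z \<in> D" "0 \<le> t"
  shows "norm (flow t x - x) \<le> t * norm (B z) + 2 * norm (x - z)"
proof (rule tendsto_upperbound)
  show "(\<lambda>n. norm (approx n t x - x)) \<longlonglongrightarrow> norm (flow t x - x)"
    by (intro tendsto_intros approx_tendsto assms)
  show "\<forall>\<^sub>F n in sequentially. norm (approx n t x - x) \<le> t * norm (B z) + 2 * norm (x - z)"
  proof (intro always_eventually allI)
    fix n
    have "norm (approx n t x - x) \<le> nat \<lfloor>t * 2 ^ n\<rfloor> * mesh n * norm (B z) + 2 * norm (x - z)"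
      unfolding approx_def by (rule steps_move[OF assms(1,2)])
    also have "\<dots> \<le> t * norm (B z) + 2 * norm (x - z)"
      by (intro add_right_mono mult_right_mono floor_bound assms) auto
    finally show "norm (approx n t x - x) \<le> t * norm (B z) + 2 * norm (x - z)" .
  qed
qed simp

lemma steps_derivative:
  assumes "x \<in> D" "z \<in> D"
  shows "norm ((step n ^^ k) x - x - (k * mesh n) *\<^sub>R B x) \<le>
    k * mesh n * (k * mesh n * norm (B z) + 2 * norm (B x - z))"
proof (induction k)
  case (Suc k)
  define C where "C = Suc k * mesh n * norm (B z) + 2 * norm (B x - z)"
  have xS: "x \<in> S" and BxS: "B x \<in> S" using assms D_in_S B_in by auto
  have "(step n ^^ Suc k) x - mesh n *\<^sub>R B ((step n ^^ Suc k) x) = (step n ^^ k) x"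
    using step_eq[OF steps_in_S[OF xS], of n k n] by simp
  then have "(step n ^^ Suc k) x - (step n ^^ k) x = mesh n *\<^sub>R (step n ^^ Suc k) (B x)"
    unfolding steps_B[OF assms(1)] by (simp add: algebra_simps)
  then have "(step n ^^ Suc k) x - x - (Suc k * mesh n) *\<^sub>R B x =
      ((step n ^^ k) x - x - (k * mesh n) *\<^sub>R B x) + mesh n *\<^sub>R ((step n ^^ Suc k) (B x) - B x)"
    by (simp add: algebra_simps)
  also have "norm \<dots> \<le> norm ((step n ^^ k) x - x - (k * mesh n) *\<^sub>R B x) +
      mesh n * norm ((step n ^^ Suc k) (B x) - B x)"
    using norm_triangle_ineq[of "(step n ^^ k) x - x - (k * mesh n) *\<^sub>R B x" "mesh n *\<^sub>R ((step n ^^ Suc k) (B x) - B x)"]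
      mesh_pos[of n] by simp
  also have "norm ((step n ^^ Suc k) (B x) - B x) \<le> C"
    unfolding C_def by (rule steps_move[OF BxS assms(2)])
  also have "norm ((step n ^^ k) x - x - (k * mesh n) *\<^sub>R B x) \<le> k * mesh n * C"
    using mesh_pos[of n] unfolding C_def
    by (intro order_trans[OF Suc] mult_left_mono add_right_mono mult_right_mono) auto
  finally show ?case using mesh_pos[of n] unfolding C_def[symmetric] by (simp add: algebra_simps)
qed simp

text \<open>
The auxiliary \<open>z\<close> approximates \<open>B x\<close>, which need not lie in the domain; for fixed \<open>z\<close> the bound is
\<open>t\<close> times a quantity that tends to \<open>2 * norm (B x - z)\<close>.
\<close>

lemma flow_derivative_bound:
  assumes "x \<in> D" "z \<in> D" "0 \<le> t"
  shows "norm (flow t x - x - t *\<^sub>R B x) \<le> t * (t * norm (B z) + 2 * norm (B x - z))"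
proof (rule tendsto_le)
  let ?k = "\<lambda>n. nat \<lfloor>t * 2 ^ n\<rfloor>"
  show "(\<lambda>n. norm ((step n ^^ ?k n) x - x - (?k n * mesh n) *\<^sub>R B x)) \<longlonglongrightarrow> norm (flow t x - x - t *\<^sub>R B x)"
    using approx_tendsto[OF D_in_S[OF assms(1)] assms(3)] unfolding approx_def
    by (intro tendsto_intros floor_tendsto assms)
  show "(\<lambda>n. ?k n * mesh n * (?k n * mesh n * norm (B z) + 2 * norm (B x - z))) \<longlonglongrightarrow>
      t * (t * norm (B z) + 2 * norm (B x - z))"
    by (intro tendsto_intros floor_tendsto assms)
  show "\<forall>\<^sub>F n in sequentially. norm ((step n ^^ ?k n) x - x - (?k n * mesh n) *\<^sub>R B x) \<le>
      ?k n * mesh n * (?k n * mesh n * norm (B z) + 2 * norm (B x - z))"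
    by (intro always_eventually allI steps_derivative assms)
qed simp

lemma flow_continuous:
  assumes "x \<in> S"
  shows "((\<lambda>t. flow t x) \<longlongrightarrow> x) (at_right 0)"
proof (rule tendstoI)
  fix e :: real assume e: "0 < e"
  obtain z where z: "z \<in> D" "norm (x - z) < e / 4" using D_approx[OF assms, of "e/4"] e by auto
  have "\<forall>\<^sub>F t in at_right 0. t * norm (B z) < e / 2" using e by (intro at_right_small) auto
  moreover have "\<forall>\<^sub>F t in at_right (0::real). 0 < t" by (simp add: eventually_at_right_less)
  ultimately show "\<forall>\<^sub>F t in at_right 0. dist (flow t x) x < e"
  proof eventually_elim
    case (elim t)
    then show ?case using flow_move[OF assms z(1), of t] z(2) e by (simp add: dist_norm)
  qed
qed

lemma flow_derivative:
  assumes "x \<in> D"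
  shows "((\<lambda>t. (1 / t) *\<^sub>R (flow t x - x)) \<longlongrightarrow> B x) (at_right 0)"
proof (rule tendstoI)
  fix e :: real assume e: "0 < e"
  obtain z where z: "z \<in> D" "norm (B x - z) < e / 4"
    using D_approx[OF B_in[OF assms], of "e/4"] e by auto
  have "\<forall>\<^sub>F t in at_right 0. t * norm (B z) < e / 2" using e by (intro at_right_small) auto
  moreover have "\<forall>\<^sub>F t in at_right (0::real). 0 < t" by (simp add: eventually_at_right_less)
  ultimately show "\<forall>\<^sub>F t in at_right 0. dist ((1 / t) *\<^sub>R (flow t x - x)) (B x) < e"
  proof eventually_elim
    case (elim t)
    have "(1 / t) *\<^sub>R (flow t x - x) - B x = (1 / t) *\<^sub>R (flow t x - x - t *\<^sub>R B x)"
      using elim by (simp add: algebra_simps)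
    then have "norm ((1 / t) *\<^sub>R (flow t x - x) - B x) = norm (flow t x - x - t *\<^sub>R B x) / t"
      using elim by simp
    also have "\<dots> \<le> t * norm (B z) + 2 * norm (B x - z)"
      using flow_derivative_bound[OF assms z(1), of t] elim by (simp add: field_simps)
    also have "\<dots> < e" using elim z(2) e by simp
    finally show ?case by (simp add: dist_norm)
  qed
qed

text \<open>
A generator cannot properly extend \<open>B\<close>: solving \<open>w - B w = x - y\<close> in the domain gives a vector
\<open>v = x - w\<close> whose orbit has derivative \<open>v\<close> at 0, hence grows initially, unless \<open>v = 0\<close>, against
contractivity.
\<close>

lemma flow_generator_maximal:
  assumes x: "x \<in> S" and y: "y \<in> S"
    and lim: "((\<lambda>t. (1 / t) *\<^sub>R (flow t x - x)) \<longlongrightarrow> y) (at_right 0)"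
  shows "x \<in> D"
proof -
  obtain w where w: "w \<in> D" "w - B w = x - y" using surj_one[OF S_diff[OF x y]] by blast
  have wS: "w \<in> S" using w D_in_S by simp
  define v where "v = x - w"
  have vS: "v \<in> S" using x wS by (simp add: v_def S_diff)
  have pos: "\<forall>\<^sub>F t in at_right (0::real). 0 < t" by (simp add: eventually_at_right_less)
  have "((\<lambda>t. (1 / t) *\<^sub>R (flow t x - x) - (1 / t) *\<^sub>R (flow t w - w) - v) \<longlongrightarrow> y - B w - v) (at_right 0)"
    by (intro tendsto_intros lim flow_derivative w)
  moreover have "y - B w - v = 0" using w(2) by (simp add: v_def algebra_simps)
  ultimately have 0: "((\<lambda>t. norm ((1 / t) *\<^sub>R (flow t x - x) - (1 / t) *\<^sub>R (flow t w - w) - v)) \<longlongrightarrow> 0) (at_right 0)"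
    by (simp add: tendsto_norm_zero)
  have "\<forall>\<^sub>F t in at_right 0. norm v \<le> norm ((1 / t) *\<^sub>R (flow t x - x) - (1 / t) *\<^sub>R (flow t w - w) - v)"
    using pos
  proof eventually_elim
    case (elim t)
    define q where "q = (1 / t) *\<^sub>R (flow t x - x) - (1 / t) *\<^sub>R (flow t w - w) - v"
    have Tv: "flow t v = flow t x - flow t w" using elim x wS by (simp add: v_def flow_diff)
    \<comment> \<open>The error \<open>q\<close> in the difference quotient of \<open>v\<close> bounds \<open>v\<close> itself.\<close>
    have "t *\<^sub>R q = flow t v - v - t *\<^sub>R v"
      using elim unfolding q_def Tv by (simp add: v_def algebra_simps)
    then have "(1 + t) *\<^sub>R v = flow t v - t *\<^sub>R q" by (simp add: algebra_simps)
    then have "norm ((1 + t) *\<^sub>R v) = norm (flow t v - t *\<^sub>R q)" by simp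
    then have "(1 + t) * norm v = norm (flow t v - t *\<^sub>R q)" using elim by simp
    also have "\<dots> \<le> norm (flow t v) + t * norm q"
      using norm_triangle_ineq4[of "flow t v" "t *\<^sub>R q"] elim by simp
    also have "norm (flow t v) \<le> norm v" using elim vS by (intro flow_contraction) auto
    finally have "t * norm v \<le> t * norm q" by (simp add: algebra_simps)
    then show ?case using elim by (simp add: q_def)
  qed
  then have "norm v \<le> 0" by (intro tendsto_lowerbound[OF 0]) auto
  then show ?thesis using w by (simp add: v_def)
qed

text \<open>
Applied to the multiplication by complex scalars, this makes the semigroup complex linear, although
the ambient Banach space is only real.
\<close>

lemma flow_commutes:
  assumes C_in: "\<And>x. x \<in> S \<Longrightarrow> C x \<in> S"
    and C_cont: "continuous_on S C"
    and C_D: "\<And>x. x \<in> D \<Longrightarrow> C x \<in> D"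
    and C_B: "\<And>x h. x \<in> D \<Longrightarrow> C (x - h *\<^sub>R B x) = C x - h *\<^sub>R B (C x)"
    and x: "x \<in> S" and t: "0 \<le> t"
  shows "flow t (C x) = C (flow t x)"
proof -
  have CR: "step n (C x) = C (step n x)" if "x \<in> S" for n x
    using step_unique[OF C_D[OF step_in_D[OF that]]] C_B[OF step_in_D[OF that]] step_eq[OF that] by metis
  have CRp: "(step n ^^ k) (C x) = C ((step n ^^ k) x)" for n k
    by (induction k) (auto simp: CR steps_in_S x)
  have "(\<lambda>n. C (approx n t x)) \<longlonglongrightarrow> C (flow t x)"
    using C_cont x t by (intro continuous_on_tendsto_compose[OF C_cont approx_tendsto]) (auto simp: flow_in_S approx_in_S)
  moreover have "(\<lambda>n. approx n t (C x)) \<longlonglongrightarrow> flow t (C x)" using x t C_in by (intro approx_tendsto)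
  ultimately show ?thesis by (auto simp: approx_def CRp intro: LIMSEQ_unique)
qed

end

section \<open>Hilbert spaces with a carrier inside a Banach space\<close>

lemma subspace_closure:
  fixes N :: "'e::real_normed_vector set"
  assumes "subspace N"
  shows "subspace (closure N)"
  unfolding subspace_def
proof (intro conjI ballI allI)
  show "0 \<in> closure N" using subspace_0[OF assms] closure_subset by blast
next
  fix u v assume "u \<in> closure N" "v \<in> closure N"
  then obtain f g where "\<And>n. f n \<in> N" "f \<longlonglongrightarrow> u" "\<And>n. g n \<in> N" "g \<longlonglongrightarrow> v"
    unfolding closure_sequential by blast
  then show "u + v \<in> closure N"
    unfolding closure_sequential
    by (intro exI[of _ "\<lambda>n. f n + g n"]) (auto intro: tendsto_add subspace_add[OF assms])
next
  fix u c assume "u \<in> closure N"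
  then obtain f where "\<And>n. f n \<in> N" "f \<longlonglongrightarrow> u"
    unfolding closure_sequential by blast
  then show "c *\<^sub>R u \<in> closure N"
    unfolding closure_sequential
    by (intro exI[of _ "\<lambda>n. c *\<^sub>R f n"]) (auto intro: tendsto_intros subspace_scale[OF assms])
qed

instance bcontfun :: (metric_space, banach) banach ..

text \<open>
Every vector becomes the bounded function that pairs it with all unit directions; by Cauchy-Schwarz
its supremum norm is the norm of the vector, and real parts suffice for this. The discrete topology
on the arguments makes every function continuous. The value at the zero vector is 0 because division by zero gives 0.
\<close>

definition emb :: "'a hilbert \<Rightarrow> 'a \<Rightarrow> ('a discrete \<Rightarrow>\<^sub>C real)"
  where "emb H x = Bcontfun (\<lambda>d. if of_discrete d \<in> carrier H
    then Re (inner_prod H x (of_discrete d)) / hnorm H (of_discrete d) else 0)"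

context complex_inner_product_space
begin

lemma carrier_field [simp]: "carrier complex_field = UNIV"
  by (simp add: complex_field_def)

lemma smult_smult: "x \<in> carrier H \<Longrightarrow> c \<odot> (d \<odot> x) = (c * d) \<odot> x"
  using smult_assoc1[of c d x] by (simp add: complex_field_def)

lemma add_smult: "x \<in> carrier H \<Longrightarrow> (c + d) \<odot> x = c \<odot> x \<oplus> d \<odot> x"
  using smult_l_distr[of c d x] by (simp add: complex_field_def)

lemma minus_eq_smult: "x \<in> carrier H \<Longrightarrow> \<ominus> x = (- 1) \<odot> x"
proof -
  assume x: "x \<in> carrier H"
  have "(- 1) \<odot> x \<oplus> x = 0 \<odot> x"
    using add_smult[OF x, of "-1" 1] one_smult[OF x] by simp
  also have "\<dots> = \<zero>" using smult_l_null[OF x] by (simp add: complex_field_def)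
  finally show ?thesis using x by (simp add: minus_equality)
qed

lemma smult_diff:
  assumes "x \<in> carrier H" "y \<in> carrier H"
  shows "c \<odot> (x \<ominus> y) = c \<odot> x \<ominus> c \<odot> y"
  using assms by (simp add: minus_eq minus_eq_smult smult_r_distr smult_smult)

lemma inner_add_right:
  "\<lbrakk>x \<in> carrier H; y \<in> carrier H; z \<in> carrier H\<rbrakk> \<Longrightarrow>
    inner_prod H x (y \<oplus> z) = inner_prod H x y + inner_prod H x z"
  using inner_add_left[of y z x] inner_commute[of "y \<oplus> z" x] inner_commute[of y x] inner_commute[of z x]
  by simp

lemma inner_smult_right:
  "\<lbrakk>x \<in> carrier H; y \<in> carrier H\<rbrakk> \<Longrightarrow>
    inner_prod H x (c \<odot> y) = cnj c * inner_prod H x y"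
  using inner_smult_left[of y x c] inner_commute[of "c \<odot> y" x] inner_commute[of y x]
  by simp

lemma inner_diff_left:
  "\<lbrakk>x \<in> carrier H; y \<in> carrier H; z \<in> carrier H\<rbrakk> \<Longrightarrow>
    inner_prod H (x \<ominus> y) z = inner_prod H x z - inner_prod H y z"
  by (simp add: minus_eq minus_eq_smult inner_add_left inner_smult_left)

lemma inner_diff_right:
  "\<lbrakk>x \<in> carrier H; y \<in> carrier H; z \<in> carrier H\<rbrakk> \<Longrightarrow>
    inner_prod H x (y \<ominus> z) = inner_prod H x y - inner_prod H x z"
  by (simp add: minus_eq minus_eq_smult inner_add_right inner_smult_right)

lemma inner_zero_left: "x \<in> carrier H \<Longrightarrow> inner_prod H \<zero> x = 0"
  using inner_add_left[of \<zero> \<zero> x] by simp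

lemma Re_inner_commute:
  "\<lbrakk>x \<in> carrier H; y \<in> carrier H\<rbrakk> \<Longrightarrow> Re (inner_prod H y x) = Re (inner_prod H x y)"
  using inner_commute[of x y] by simp

lemma hnorm_nonneg: "x \<in> carrier H \<Longrightarrow> 0 \<le> hnorm H x"
  by (simp add: hnorm_def inner_nonneg)

lemma hnorm_square: "x \<in> carrier H \<Longrightarrow> (hnorm H x)\<^sup>2 = Re (inner_prod H x x)"
  by (simp add: hnorm_def inner_nonneg)

lemma hnorm_smult:
  assumes "x \<in> carrier H" shows "hnorm H (c \<odot> x) = cmod c * hnorm H x"
proof -
  have "inner_prod H (c \<odot> x) (c \<odot> x) = complex_of_real ((cmod c)\<^sup>2) * inner_prod H x x"
    using assms by (simp add: inner_smult_left inner_smult_right complex_norm_square del: of_real_power)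
  then show ?thesis
    by (simp add: hnorm_def real_sqrt_mult del: of_real_power)
qed

lemma abs_Re_inner_le:
  "\<lbrakk>x \<in> carrier H; y \<in> carrier H\<rbrakk> \<Longrightarrow> \<bar>Re (inner_prod H x y)\<bar> \<le> hnorm H x * hnorm H y"
  using Re_inner_le[of x y] Re_inner_le[of "\<ominus> x" y] hnorm_minus[of x]
  by (auto simp: minus_eq_smult inner_smult_left)

lemma emb_apply:
  assumes "x \<in> carrier H"
  shows "apply_bcontfun (emb H x) d = (if of_discrete d \<in> carrier H
    then Re (inner_prod H x (of_discrete d)) / hnorm H (of_discrete d) else 0)"
proof -
  have "(\<lambda>d. if of_discrete d \<in> carrier H
      then Re (inner_prod H x (of_discrete d)) / hnorm H (of_discrete d) else 0) \<in> bcontfun"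
  proof (rule bcontfun_normI)
    show "continuous_on UNIV (\<lambda>d. if of_discrete d \<in> carrier H
        then Re (inner_prod H x (of_discrete d)) / hnorm H (of_discrete d) else 0)"
      by (auto simp: continuous_on_open_vimage intro: open_discrete)
    show "norm (if of_discrete d \<in> carrier H
        then Re (inner_prod H x (of_discrete d)) / hnorm H (of_discrete d) else 0) \<le> hnorm H x" for d
      using abs_Re_inner_le[OF assms, of "of_discrete d"] hnorm_nonneg[OF assms]
        hnorm_nonneg[of "of_discrete d"]
      by (cases "hnorm H (of_discrete d) = 0") (auto simp: divide_le_eq)
  qed
  then show ?thesis by (simp add: emb_def Bcontfun_inverse)
qed

lemma emb_add: "\<lbrakk>x \<in> carrier H; y \<in> carrier H\<rbrakk> \<Longrightarrow> emb H (x \<oplus> y) = emb H x + emb H y"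
  by (rule bcontfun_eqI) (simp add: emb_apply inner_add_left add_divide_distrib)

lemma emb_diff: "\<lbrakk>x \<in> carrier H; y \<in> carrier H\<rbrakk> \<Longrightarrow> emb H (x \<ominus> y) = emb H x - emb H y"
  by (rule bcontfun_eqI) (simp add: emb_apply inner_diff_left diff_divide_distrib)

lemma emb_scaleR: "x \<in> carrier H \<Longrightarrow> emb H (complex_of_real r \<odot> x) = r *\<^sub>R emb H x"
  by (rule bcontfun_eqI) (simp add: emb_apply inner_smult_left)

lemma emb_zero: "emb H \<zero> = 0"
  by (rule bcontfun_eqI) (simp add: emb_apply inner_zero_left)

lemma norm_emb:
  assumes "x \<in> carrier H"
  shows "norm (emb H x) = hnorm H x"
proof (rule antisym)
  show "norm (emb H x) \<le> hnorm H x"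
  proof (rule norm_bound)
    show "norm (apply_bcontfun (emb H x) d) \<le> hnorm H x" for d
      using abs_Re_inner_le[OF assms, of "of_discrete d"] hnorm_nonneg[OF assms]
        hnorm_nonneg[of "of_discrete d"] assms
      by (cases "hnorm H (of_discrete d) = 0") (auto simp: emb_apply divide_le_eq)
  qed
  have "apply_bcontfun (emb H x) (discrete x) = hnorm H x"
    using assms hnorm_nonneg[OF assms]
    by (simp add: emb_apply discrete_inverse flip: hnorm_square) (simp add: power2_eq_square)
  then show "hnorm H x \<le> norm (emb H x)"
    using norm_bounded[of "emb H x" "discrete x"] by simp
qed

text \<open>
For \<open>z\<close> the value at \<open>x\<close> of a dissipative operator, expanding the square of the right-hand side
shows the inequality, since the mixed term has the right sign.
\<close>

lemma norm_le_dissipative: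
  assumes x: "x \<in> carrier H" and z: "z \<in> carrier H"
    and diss: "Re (inner_prod H z x) \<le> 0" and h: "0 \<le> h"
  shows "norm (emb H x) \<le> norm (emb H x - h *\<^sub>R emb H z)"
proof -
  define y where "y = x \<oplus> complex_of_real (- h) \<odot> z"
  have yH: "y \<in> carrier H" using x z by (simp add: y_def)
  have "(hnorm H y)\<^sup>2 = (hnorm H x)\<^sup>2 - 2 * (h * Re (inner_prod H z x)) + h\<^sup>2 * (hnorm H z)\<^sup>2"
    using x z inner_expand[of x z "- h", folded y_def] Re_inner_commute[of x z] yH
    by (simp add: hnorm_square)
  moreover have "0 \<le> h\<^sup>2 * (hnorm H z)\<^sup>2" by simp
  moreover have "h * Re (inner_prod H z x) \<le> 0"
    using h diss by (simp add: mult_nonneg_nonpos)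
  ultimately have "(hnorm H x)\<^sup>2 \<le> (hnorm H y)\<^sup>2" by linarith
  then have "hnorm H x \<le> hnorm H y" using hnorm_nonneg[OF yH] by (rule power2_le_imp_le)
  then have "norm (emb H x) \<le> norm (emb H y)" using x yH by (simp add: norm_emb)
  also have "emb H y = emb H x - h *\<^sub>R emb H z"
    using x z emb_scaleR[of z "- h"] by (simp add: y_def emb_add)
  finally show ?thesis .
qed

lemma dist_emb: "\<lbrakk>x \<in> carrier H; y \<in> carrier H\<rbrakk> \<Longrightarrow> dist (emb H x) (emb H y) = hdist H x y"
  by (simp add: dist_norm hdist_def norm_emb flip: emb_diff)

lemma emb_eq_iff: "\<lbrakk>x \<in> carrier H; y \<in> carrier H\<rbrakk> \<Longrightarrow> emb H x = emb H y \<longleftrightarrow> x = y"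
  using dist_emb[of x y] Metric_space.zero[OF Metric_space_hdist, of x y] by auto

lemma htopology_eq: "htopology H = Metric_space.mtopology (carrier H) (hdist H)"
  by (simp add: mtopology_of_def mspace_hmetric mdist_hmetric)

lemma limitin_iff_emb:
  assumes "\<And>t. P t \<Longrightarrow> f t \<in> carrier H" "eventually P F"
  shows "limitin (htopology H) f l F \<longleftrightarrow>
    l \<in> carrier H \<and> ((\<lambda>t. emb H (f t)) \<longlongrightarrow> emb H l) F"
proof (cases "l \<in> carrier H")
  case True
  have "limitin (htopology H) f l F \<longleftrightarrow>
      (\<forall>\<epsilon>>0. \<forall>\<^sub>F t in F. f t \<in> carrier H \<and> hdist H (f t) l < \<epsilon>)"
    by (simp add: htopology_eq Metric_space.limitin_metric[OF Metric_space_hdist] True)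
  also have "\<dots> \<longleftrightarrow> (\<forall>\<epsilon>>0. \<forall>\<^sub>F t in F. dist (emb H (f t)) (emb H l) < \<epsilon>)"
  proof (intro all_cong1 imp_cong refl iffI)
    fix e :: real
    assume "\<forall>\<^sub>F t in F. f t \<in> carrier H \<and> hdist H (f t) l < e"
    then show "\<forall>\<^sub>F t in F. dist (emb H (f t)) (emb H l) < e"
      by (rule eventually_mono) (simp add: dist_emb True)
  next
    fix e :: real
    assume "\<forall>\<^sub>F t in F. dist (emb H (f t)) (emb H l) < e"
    with assms(2) show "\<forall>\<^sub>F t in F. f t \<in> carrier H \<and> hdist H (f t) l < e"
      by eventually_elim (use assms(1) True in \<open>auto simp: dist_emb\<close>)
  qed
  also have "\<dots> \<longleftrightarrow> ((\<lambda>t. emb H (f t)) \<longlongrightarrow> emb H l) F" by (simp add: tendsto_iff)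
  finally show ?thesis using True by simp
next
  case False
  then show ?thesis
    by (simp add: htopology_eq Metric_space.limitin_metric[OF Metric_space_hdist])
qed

text \<open>
A convergent sequence in the image comes from a Cauchy sequence in the carrier, which converges there
by completeness; hence closed subsets of the carrier stay closed in the larger Banach space.
\<close>

lemma closed_emb_image:
  assumes M: "M \<subseteq> carrier H" and complete: "mcomplete_of (hmetric H)"
  shows "closed (emb H ` M) \<longleftrightarrow> closedin (htopology H) M"
proof -
  have seq: "closedin (htopology H) M \<longleftrightarrow>
      (\<forall>\<sigma> l. range \<sigma> \<subseteq> M \<and> limitin (htopology H) \<sigma> l sequentially \<longrightarrow> l \<in> M)"
    using M by (simp add: htopology_eq Metric_space.metric_closedin_iff_sequentially_closed[OF Metric_space_hdist])
  show ?thesis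
  proof
    assume cl: "closed (emb H ` M)"
    show "closedin (htopology H) M"
      unfolding seq
    proof (intro allI impI, elim conjE)
      fix \<sigma> l assume \<sigma>: "range \<sigma> \<subseteq> M" "limitin (htopology H) \<sigma> l sequentially"
      then have l: "l \<in> carrier H" and lim: "(\<lambda>n. emb H (\<sigma> n)) \<longlonglongrightarrow> emb H l"
        using M limitin_iff_emb[of "\<lambda>_. True" \<sigma> sequentially l] by auto
      have "emb H (\<sigma> n) \<in> emb H ` M" for n using \<sigma>(1) by blast
      from closed_sequentially[OF cl this lim] have "emb H l \<in> emb H ` M" .
      then show "l \<in> M" using M \<open>l \<in> carrier H\<close> emb_eq_iff by blast
    qed
  next
    assume cl: "closedin (htopology H) M"
    show "closed (emb H ` M)"
      unfolding closed_sequential_limits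
    proof (intro allI impI, elim conjE)
      fix u l assume u: "\<forall>n. u n \<in> emb H ` M" "u \<longlonglongrightarrow> l"
      then have "\<exists>x. x \<in> M \<and> u n = emb H x" for n by auto
      then obtain \<sigma> where \<sigma>: "\<And>n. \<sigma> n \<in> M" "\<And>n. u n = emb H (\<sigma> n)" by metis
      have "Cauchy u" using u(2) LIMSEQ_imp_Cauchy by blast
      then have "Metric_space.MCauchy (carrier H) (hdist H) \<sigma>"
        using \<sigma> M unfolding Metric_space.MCauchy_def[OF Metric_space_hdist] Cauchy_def
        by (auto simp: subset_eq) (metis dist_emb subset_eq)
      then obtain x where x: "limitin (htopology H) \<sigma> x sequentially"
        using complete unfolding mcomplete_of_def Metric_space.mcomplete_def[OF Metric_space_hdist]
          mspace_hmetric mdist_hmetric htopology_eq by blast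
      have "range \<sigma> \<subseteq> M" using \<sigma>(1) by blast
      with cl x have "x \<in> M" unfolding seq by blast
      have "\<sigma> n \<in> carrier H" for n using \<sigma>(1) M by blast
      with x have "(\<lambda>n. emb H (\<sigma> n)) \<longlonglongrightarrow> emb H x"
        using limitin_iff_emb[of "\<lambda>_. True" \<sigma> sequentially x] by simp
      with \<open>x \<in> M\<close>
      show "l \<in> emb H ` M"
        using u(2) LIMSEQ_unique[of u l "emb H x"] by (simp add: \<sigma>(2)[abs_def, symmetric])
    qed
  qed
qed

lemma submoduleD:
  assumes "submodule M complex_field H"
  shows "M \<subseteq> carrier H" and "\<zero> \<in> M"
    and "\<And>u v. u \<in> M \<Longrightarrow> v \<in> M \<Longrightarrow> u \<oplus> v \<in> M"
    and "\<And>c u. u \<in> M \<Longrightarrow> c \<odot> u \<in> M"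
proof -
  show M: "M \<subseteq> carrier H" and "\<And>u v. u \<in> M \<Longrightarrow> v \<in> M \<Longrightarrow> u \<oplus> v \<in> M"
    and smult: "\<And>c u. u \<in> M \<Longrightarrow> c \<odot> u \<in> M"
    using submoduleE[OF assms] by auto
  obtain u where "u \<in> M" using submoduleE(2)[OF assms] by blast
  then show "\<zero> \<in> M" using smult[of u 0] smult_l_null[of u] M by (auto simp: complex_field_def)
qed

lemma submodule_criterion:
  assumes "M \<subseteq> carrier H" and "\<zero> \<in> M"
    and "\<And>u v. u \<in> M \<Longrightarrow> v \<in> M \<Longrightarrow> u \<oplus> v \<in> M"
    and "\<And>c u. u \<in> M \<Longrightarrow> c \<odot> u \<in> M"
  shows "submodule M complex_field H"
  using assms minus_eq_smult by (intro submoduleI) (auto simp: subset_eq)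

lemma subspace_emb_image:
  assumes "submodule M complex_field H" shows "subspace (emb H ` M)"
  unfolding subspace_def
proof (intro conjI ballI allI)
  note M = submoduleD[OF assms]
  show "0 \<in> emb H ` M" using M(2) emb_zero by (metis imageI)
  show "u + v \<in> emb H ` M" if "u \<in> emb H ` M" "v \<in> emb H ` M" for u v
    using that M(1,3) by (auto simp: subset_eq simp flip: emb_add)
  show "r *\<^sub>R u \<in> emb H ` M" if "u \<in> emb H ` M" for r u
    using that M(1,4) by (auto simp: subset_eq simp flip: emb_scaleR)
qed

lemma subspace_emb: "subspace (emb H ` carrier H)"
  by (rule subspace_emb_image[OF carrier_is_submodule])

lemma parallelogram:
  assumes "u \<in> emb H ` carrier H" "v \<in> emb H ` carrier H"
  shows "(norm (u + v))\<^sup>2 + (norm (u - v))\<^sup>2 = 2 * (norm u)\<^sup>2 + 2 * (norm v)\<^sup>2"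
proof -
  obtain x y where "x \<in> carrier H" "y \<in> carrier H" "u = emb H x" "v = emb H y" using assms by auto
  then show ?thesis
    by (simp add: norm_emb hnorm_square inner_add_left inner_add_right inner_diff_left inner_diff_right
        flip: emb_add emb_diff)
qed

end

context complex_hilbert_space
begin

lemma closed_emb: "closed (emb H ` carrier H)"
  using closed_emb_image[OF order_refl complete] Metric_space.closedin_mspace[OF Metric_space_hdist]
  by (simp add: htopology_eq)

end

section \<open>Orthogonal decomposition\<close>

context complex_hilbert_space
begin

text \<open>
The classical argument: the parallelogram law makes every minimizing sequence a Cauchy sequence.
\<close>

lemma nearest_point:
  assumes x: "x \<in> carrier H"
    and N: "N \<subseteq> emb H ` carrier H" "closed N" "subspace N"
  shows "\<exists>p\<in>N. \<forall>m\<in>N. norm (emb H x - p) \<le> norm (emb H x - m)"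
proof -
  define z where "z = emb H x"
  have zS: "z \<in> emb H ` carrier H" using x by (simp add: z_def)
  have "N \<noteq> {}" using subspace_0[OF N(3)] by blast
  define d where "d = infdist z N"
  have d: "d \<le> norm (z - m)" if "m \<in> N" for m
    using infdist_le[OF that, of z] by (simp add: d_def dist_norm)
  have d0: "0 \<le> d" by (simp add: d_def infdist_nonneg)
  have "\<exists>m\<in>N. norm (z - m) < d + 1 / Suc n" for n
  proof -
    have "infdist z N < d + 1 / Suc n" by (simp add: d_def)
    then have "\<exists>m\<in>N. dist z m < d + 1 / Suc n"
      using \<open>N \<noteq> {}\<close> by (auto simp: infdist_def cINF_less_iff)
    then show ?thesis by (simp add: dist_norm)
  qed
  then obtain m where m: "\<And>n. m n \<in> N" "\<And>n. norm (z - m n) < d + 1 / Suc n" by metis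
  have lim: "(\<lambda>n. d + 1 / Suc n) \<longlonglongrightarrow> d"
    using tendsto_add[OF tendsto_const LIMSEQ_inverse_real_of_nat, of d] by (simp add: inverse_eq_divide)
  \<comment> \<open>The midpoint of \<open>m i\<close> and \<open>m j\<close> is at distance at least \<open>d\<close> from \<open>z\<close>.\<close>
  have close: "(norm (m i - m j))\<^sup>2 \<le> 2 * ((d + 1 / Suc i)\<^sup>2 - d\<^sup>2) + 2 * ((d + 1 / Suc j)\<^sup>2 - d\<^sup>2)" for i j
  proof -
    have "(1/2) *\<^sub>R (m i + m j) \<in> N" using m N(3) by (intro subspace_scale subspace_add)
    then have "d \<le> norm (z - (1/2) *\<^sub>R (m i + m j))" by (rule d)
    also have "z - (1/2) *\<^sub>R (m i + m j) = (1/2) *\<^sub>R ((z - m i) + (z - m j))"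
      by (simp add: algebra_simps flip: scaleR_2)
    finally have "2 * d \<le> norm ((z - m i) + (z - m j))" by simp
    then have "(2 * d)\<^sup>2 \<le> (norm ((z - m i) + (z - m j)))\<^sup>2" using d0 by (intro power_mono) auto
    moreover have "(norm ((z - m i) + (z - m j)))\<^sup>2 + (norm ((z - m i) - (z - m j)))\<^sup>2 =
        2 * (norm (z - m i))\<^sup>2 + 2 * (norm (z - m j))\<^sup>2"
      using zS m N(1) by (intro parallelogram subspace_diff[OF subspace_emb]) auto
    moreover have "norm ((z - m i) - (z - m j)) = norm (m i - m j)"
      using norm_minus_commute[of "m i" "m j"] by simp
    moreover have "(norm (z - m i))\<^sup>2 \<le> (d + 1 / Suc i)\<^sup>2" "(norm (z - m j))\<^sup>2 \<le> (d + 1 / Suc j)\<^sup>2"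
      using m(2)[of i] m(2)[of j] by (auto intro!: power_mono)
    ultimately show ?thesis by (simp add: power_mult_distrib)
  qed
  have "(\<lambda>n. 2 * ((d + 1 / Suc n)\<^sup>2 - d\<^sup>2)) \<longlonglongrightarrow> 2 * (d\<^sup>2 - d\<^sup>2)" by (intro tendsto_intros lim)
  then have lim0: "(\<lambda>n. 2 * ((d + 1 / Suc n)\<^sup>2 - d\<^sup>2)) \<longlonglongrightarrow> 0" by simp
  have "Cauchy m"
  proof (rule CauchyI)
    fix e :: real assume e: "0 < e"
    then have "\<forall>\<^sub>F n in sequentially. 2 * ((d + 1 / Suc n)\<^sup>2 - d\<^sup>2) < e\<^sup>2 / 2"
      by (intro order_tendstoD(2)[OF lim0]) auto
    then obtain K where K: "\<And>n. n \<ge> K \<Longrightarrow> 2 * ((d + 1 / Suc n)\<^sup>2 - d\<^sup>2) < e\<^sup>2 / 2"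
      by (auto simp: eventually_sequentially)
    have "norm (m i - m j) < e" if "i \<ge> K" "j \<ge> K" for i j
    proof (rule power2_less_imp_less)
      show "(norm (m i - m j))\<^sup>2 < e\<^sup>2"
        using close[of i j] K[OF that(1)] K[OF that(2)] by linarith
    qed (use e in simp)
    then show "\<exists>M. \<forall>i\<ge>M. \<forall>j\<ge>M. norm (m i - m j) < e" by blast
  qed
  then obtain p where p: "m \<longlonglongrightarrow> p" by (auto simp: Cauchy_convergent_iff convergent_def)
  have "p \<in> N" using closed_sequentially[OF N(2) m(1) p] .
  moreover have "norm (z - p) \<le> d"
  proof (rule tendsto_le[OF _ lim])
    show "(\<lambda>n. norm (z - m n)) \<longlonglongrightarrow> norm (z - p)" by (intro tendsto_intros p)
    show "\<forall>\<^sub>F n in sequentially. norm (z - m n) \<le> d + 1 / Suc n"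
      using m(2) by (intro always_eventually) (auto intro: less_imp_le)
  qed simp
  ultimately show ?thesis using d order_trans unfolding z_def by blast
qed

text \<open>
First variation: the derivative in \<open>t\<close> of the squared norm vanishes at a minimum.
\<close>

lemma Re_zero_if_nearest:
  assumes q: "q \<in> carrier H" and y: "y \<in> carrier H"
    and near: "\<And>t. hnorm H q \<le> hnorm H (q \<oplus> complex_of_real t \<odot> y)"
  shows "Re (inner_prod H q y) = 0"
proof (rule ccontr)
  let ?b = "Re (inner_prod H q y)" and ?c = "Re (inner_prod H y y)"
  assume b: "?b \<noteq> 0"
  have nn: "0 \<le> 2 * t * ?b + t\<^sup>2 * ?c" for t
  proof -
    have "(hnorm H q)\<^sup>2 \<le> (hnorm H (q \<oplus> complex_of_real t \<odot> y))\<^sup>2"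
      using near q by (intro power_mono hnorm_nonneg)
    then show ?thesis using q y by (simp add: hnorm_square inner_expand)
  qed
  have "0 \<le> ?c" using y by (rule inner_nonneg)
  \<comment> \<open>The quadratic in \<open>t\<close> is negative near 0 on one side; the 1 only avoids a division by zero.\<close>
  define t where "t = - ?b / (?c + 1)"
  have "2 * t * ?b + t\<^sup>2 * ?c = - ?b\<^sup>2 * (?c + 2) / (?c + 1)\<^sup>2"
    using \<open>0 \<le> ?c\<close> by (simp add: t_def field_simps power2_eq_square add_nonneg_eq_0_iff)
  also have "\<dots> < 0" using b \<open>0 \<le> ?c\<close> by (intro divide_neg_pos mult_neg_pos) auto
  finally show False using nn[of t] by simp
qed

text \<open>
Stated for real subspaces of the ambient Banach space, so that it applies to closures taken there.
\<close>

lemma real_orthogonal_decomposition: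
  assumes x: "x \<in> carrier H"
    and N: "N \<subseteq> emb H ` carrier H" "closed N" "subspace N"
  obtains p where "p \<in> carrier H" "emb H p \<in> N"
    "\<And>m. m \<in> carrier H \<Longrightarrow> emb H m \<in> N \<Longrightarrow> Re (inner_prod H (x \<ominus> p) m) = 0"
proof -
  obtain u where u: "u \<in> N" and near: "\<And>m. m \<in> N \<Longrightarrow> norm (emb H x - u) \<le> norm (emb H x - m)"
    using nearest_point[OF x N] by blast
  from u N(1) obtain p where p: "p \<in> carrier H" "u = emb H p" by blast
  define q where "q = x \<ominus> p"
  have qH: "q \<in> carrier H" using x p by (simp add: q_def)
  have "Re (inner_prod H q m) = 0" if mH: "m \<in> carrier H" and m: "emb H m \<in> N" for m
  proof (rule Re_zero_if_nearest[OF qH mH])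
    fix t
    have "u - t *\<^sub>R emb H m \<in> N" using u m N(3) by (intro subspace_diff subspace_scale)
    from near[OF this] have "norm (emb H q) \<le> norm (emb H (q \<oplus> complex_of_real t \<odot> m))"
      using x p mH qH by (simp add: emb_add emb_diff emb_scaleR q_def algebra_simps)
    then show "hnorm H q \<le> hnorm H (q \<oplus> complex_of_real t \<odot> m)"
      using qH mH by (simp add: norm_emb)
  qed
  then show thesis using that p u by (simp add: q_def)
qed

lemma orthogonal_decomposition:
  assumes M: "submodule M complex_field H" "closedin (htopology H) M" and x: "x \<in> carrier H"
  obtains p where "p \<in> M" "\<And>m. m \<in> M \<Longrightarrow> inner_prod H (x \<ominus> p) m = 0"
proof -
  note sub = submoduleD[OF M(1)]
  have "emb H ` M \<subseteq> emb H ` carrier H" using sub(1) by blast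
  moreover have "closed (emb H ` M)" using closed_emb_image[OF sub(1) complete] M(2) by simp
  ultimately obtain p where p: "p \<in> carrier H" "emb H p \<in> emb H ` M"
    "\<And>m. m \<in> carrier H \<Longrightarrow> emb H m \<in> emb H ` M \<Longrightarrow> Re (inner_prod H (x \<ominus> p) m) = 0"
    using real_orthogonal_decomposition[OF x _ _ subspace_emb_image[OF M(1)]] by blast
  have "p \<in> M" using p(1,2) sub(1) emb_eq_iff by blast
  have re: "Re (inner_prod H (x \<ominus> p) m) = 0" if "m \<in> M" for m
    using p(3) that sub(1) by blast
  \<comment> \<open>The imaginary part is the real part of the product with \<open>\<i> m\<close>.\<close>
  have "inner_prod H (x \<ominus> p) m = 0" if "m \<in> M" for m
    using re[OF that] re[OF sub(4)[OF that, of \<i>]] that sub(1) x p(1)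
    by (auto simp: inner_smult_right complex_eq_iff subset_eq)
  then show thesis using that \<open>p \<in> M\<close> by blast
qed

end

section \<open>The Lumer-Phillips theorem in Hilbert space\<close>

context complex_hilbert_space
begin

text \<open>
The operator is transported to the Banach space of \<open>emb\<close>, where the implicit Euler scheme yields the
semigroup. The density of the domain comes from the geometry of Hilbert space: if \<open>q\<close> is orthogonal to
\<open>D\<close> and \<open>q = y - B y\<close>, then pairing with \<open>y\<close> gives \<open>\<parallel>y\<parallel>\<^sup>2 = Re \<langle>B y, y\<rangle> \<le> 0\<close>, so \<open>q = 0\<close>.
\<close>

theorem lumer_phillips:
  assumes op: "linear_operator H D B" and diss: "dissipative H D B"
    and onto: "\<And>x. x \<in> carrier H \<Longrightarrow> \<exists>y\<in>D. y \<ominus> B y = x"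
  shows "generates_contraction_semigroup H D B"
proof -
  have sub_D: "submodule D complex_field H" using op by (simp add: linear_operator_def)
  note D = submoduleD[OF sub_D]
  have DH: "x \<in> carrier H" if "x \<in> D" for x using D(1) that by blast
  have B_in: "B x \<in> carrier H" if "x \<in> D" for x
    using op that by (auto simp: linear_operator_def)
  have B_add: "B (x \<oplus> y) = B x \<oplus> B y" if "x \<in> D" "y \<in> D" for x y
    using op that by (simp add: linear_operator_def)
  have B_smult: "B (c \<odot> x) = c \<odot> B x" if "x \<in> D" for c x
    using op that by (simp add: linear_operator_def)
  define r where "r = inv_into (carrier H) (emb H)"
  have r_emb: "r (emb H x) = x" if "x \<in> carrier H" for x
    using that unfolding r_def by (intro inv_into_f_f) (auto simp: inj_on_def emb_eq_iff)
  have r_in: "r u \<in> carrier H" and emb_r: "emb H (r u) = u" if "u \<in> emb H ` carrier H" for u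
    using that r_emb by auto
  define BE where "BE = (\<lambda>u. emb H (B (r u)))"
  have BE: "BE (emb H x) = emb H (B x)" if "x \<in> D" for x
    using that DH by (simp add: BE_def r_emb)
  have dense: "emb H ` carrier H \<subseteq> closure (emb H ` D)"
  proof
    fix u assume "u \<in> emb H ` carrier H"
    then obtain x where x: "x \<in> carrier H" "u = emb H x" by blast
    have "closure (emb H ` D) \<subseteq> emb H ` carrier H"
      using D(1) closed_emb by (intro closure_minimal image_mono)
    then obtain p where p: "p \<in> carrier H" "emb H p \<in> closure (emb H ` D)"
      and orth: "\<And>m. m \<in> carrier H \<Longrightarrow> emb H m \<in> closure (emb H ` D) \<Longrightarrow> Re (inner_prod H (x \<ominus> p) m) = 0"
      using real_orthogonal_decomposition[OF x(1) _ closed_closure subspace_closure[OF subspace_emb_image[OF sub_D]]]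
      by blast
    obtain y where y: "y \<in> D" "y \<ominus> B y = x \<ominus> p" using onto x p by (meson minus_closed)
    have yH: "y \<in> carrier H" "B y \<in> carrier H" using y DH B_in by auto
    have "Re (inner_prod H (y \<ominus> B y) y) = 0"
      unfolding y(2) using y(1) yH closure_subset[of "emb H ` D"] by (intro orth) auto
    then have "Re (inner_prod H y y) = Re (inner_prod H (B y) y)"
      using yH by (simp add: inner_diff_left)
    also have "\<dots> \<le> 0" using diss y(1) by (simp add: dissipative_def)
    finally have "y = \<zero>" using inner_pos[OF yH(1)] by fastforce
    have "B y = \<zero>" using B_smult[OF y(1), of 0] yH y(1) smult_l_null[OF yH(1)] smult_l_null[OF yH(2)]
      by (simp add: complex_field_def \<open>y = \<zero>\<close>)
    then have "emb H (x \<ominus> p) = 0" using y(2) \<open>y = \<zero>\<close> by (metis emb_diff emb_zero zero_closed diff_self)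
    then show "u \<in> closure (emb H ` D)" using x p by (simp add: emb_diff)
  qed
  interpret G: maximal_dissipative "emb H ` carrier H" "emb H ` D" BE
  proof
    show "subspace (emb H ` carrier H)" by (rule subspace_emb)
    show "closed (emb H ` carrier H)" by (rule closed_emb)
    show "subspace (emb H ` D)" using sub_D by (rule subspace_emb_image)
    show "emb H ` D \<subseteq> emb H ` carrier H" using D(1) by blast
    show "emb H ` carrier H \<subseteq> closure (emb H ` D)" by (rule dense)
    show "BE u \<in> emb H ` carrier H" if "u \<in> emb H ` D" for u
      using that B_in by (auto simp: BE)
    show "BE (u + v) = BE u + BE v" if "u \<in> emb H ` D" "v \<in> emb H ` D" for u v
    proof -
      obtain x y where "x \<in> D" "y \<in> D" "u = emb H x" "v = emb H y" using \<open>u \<in> _\<close> \<open>v \<in> _\<close> by blast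
      then show ?thesis using DH B_in D(3) BE[of "x \<oplus> y"] by (simp add: BE B_add emb_add)
    qed
    show "BE (c *\<^sub>R u) = c *\<^sub>R BE u" if "u \<in> emb H ` D" for c u
    proof -
      obtain x where "x \<in> D" "u = emb H x" using \<open>u \<in> _\<close> by blast
      then show ?thesis using DH B_in D(4) BE[of "complex_of_real c \<odot> x"] by (simp add: BE B_smult emb_scaleR)
    qed
    show "norm u \<le> norm (u - h *\<^sub>R BE u)" if "0 < h" "u \<in> emb H ` D" for h u
      using that norm_le_dissipative DH B_in diss by (auto simp: BE dissipative_def)
    show "\<exists>v\<in>emb H ` D. v - BE v = u" if "u \<in> emb H ` carrier H" for u
    proof -
      obtain x where x: "x \<in> carrier H" "u = emb H x" using \<open>u \<in> _\<close> by blast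
      obtain y where y: "y \<in> D" "y \<ominus> B y = x" using onto[OF x(1)] by blast
      then have "emb H y - BE (emb H y) = u"
        using emb_diff[of y "B y"] DH B_in by (simp add: BE x(2))
      then show ?thesis using y(1) by blast
    qed
  qed
  define T where "T = (\<lambda>t x. r (G.flow t (emb H x)))"
  have T_in: "T t x \<in> carrier H" and emb_T: "emb H (T t x) = G.flow t (emb H x)"
    if "0 \<le> t" "x \<in> carrier H" for t x
    using that G.flow_in_S[of "emb H x" t] r_in emb_r by (auto simp: T_def)
  have G_add: "G.flow t (u + v) = G.flow t u + G.flow t v"
    if "0 \<le> t" "u \<in> emb H ` carrier H" "v \<in> emb H ` carrier H" for t u v
  proof -
    have z: "0 \<in> emb H ` carrier H" by (metis emb_zero imageI zero_closed)
    have "0 - v \<in> emb H ` carrier H" by (rule subspace_diff[OF subspace_emb z that(3)])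
    then show ?thesis
      using that z G.flow_diff[of u "0 - v" t] G.flow_diff[of 0 v t] G.flow_diff[of 0 0 t] by simp
  qed
  have G_smult: "G.flow t (emb H (c \<odot> x)) = emb H (c \<odot> T t x)" if "0 \<le> t" "x \<in> carrier H" for t c x
  proof -
    define C where "C = (\<lambda>u. emb H (c \<odot> r u))"
    have "G.flow t (C (emb H x)) = C (G.flow t (emb H x))"
    proof (rule G.flow_commutes)
      show "C u \<in> emb H ` carrier H" if "u \<in> emb H ` carrier H" for u
        using that r_in by (simp add: C_def)
      have "dist (C u) (C v) \<le> cmod c * dist u v"
        if "u \<in> emb H ` carrier H" "v \<in> emb H ` carrier H" for u v
        using that by (auto simp: C_def r_emb dist_norm norm_emb hnorm_smult
            simp flip: emb_diff smult_diff)
      then show "continuous_on (emb H ` carrier H) C"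
        by (intro lipschitz_on_continuous_on[of "cmod c"] lipschitz_onI) auto
      show "C u \<in> emb H ` D" if "u \<in> emb H ` D" for u
        using that DH D(4) by (auto simp: C_def r_emb)
      show "C (u - h *\<^sub>R BE u) = C u - h *\<^sub>R BE (C u)" if "u \<in> emb H ` D" for u h
      proof -
        obtain x where x: "x \<in> D" "u = emb H x" using \<open>u \<in> _\<close> by blast
        have xH: "x \<in> carrier H" "B x \<in> carrier H" using x DH B_in by auto
        have "u - h *\<^sub>R BE u = emb H (x \<ominus> complex_of_real h \<odot> B x)"
          using x xH by (simp add: BE emb_diff emb_scaleR)
        then have "C (u - h *\<^sub>R BE u) = emb H (c \<odot> x \<ominus> complex_of_real h \<odot> (c \<odot> B x))"
          using xH by (simp add: C_def r_emb smult_diff smult_smult mult.commute)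
        also have "\<dots> = emb H (c \<odot> x) - h *\<^sub>R BE (emb H (c \<odot> x))"
          using x xH D(4) by (simp add: BE B_smult emb_diff emb_scaleR)
        finally show ?thesis using x xH by (simp add: C_def r_emb)
      qed
    qed (use that in auto)
    then show ?thesis using that by (simp add: C_def r_emb T_def)
  qed
  have "contraction_semigroup H T"
    unfolding contraction_semigroup_def
  proof (intro conjI allI impI ballI)
    show "linear_operator H (carrier H) (T t)" if "0 \<le> t" for t
      unfolding linear_operator_def
    proof (intro conjI allI ballI)
      show "submodule (carrier H) complex_field H" by (rule carrier_is_submodule)
      show "T t \<in> carrier H \<rightarrow> carrier H" using T_in that by blast
      show "T t (x \<oplus> y) = T t x \<oplus> T t y" if "x \<in> carrier H" "y \<in> carrier H" for x y
      proof -
        have "emb H (T t (x \<oplus> y)) = emb H (T t x \<oplus> T t y)"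
          using that \<open>0 \<le> t\<close> by (simp add: emb_T emb_add T_in G_add)
        then show ?thesis using that \<open>0 \<le> t\<close> by (simp add: emb_eq_iff T_in)
      qed
      show "T t (c \<odot> x) = c \<odot> T t x" if "x \<in> carrier H" for c x
      proof -
        have "emb H (T t (c \<odot> x)) = emb H (c \<odot> T t x)"
          using that \<open>0 \<le> t\<close> by (simp add: emb_T G_smult)
        then show ?thesis using that \<open>0 \<le> t\<close> by (simp add: emb_eq_iff T_in)
      qed
    qed
    show "hnorm H (T t x) \<le> hnorm H x" if "0 \<le> t" "x \<in> carrier H" for t x
      using G.flow_contraction[of "emb H x" t] that by (simp add: T_in emb_T flip: norm_emb)
    show "T 0 x = x" if "x \<in> carrier H" for x
      using that by (simp add: T_def G.flow_0 r_emb)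
    show "T (s + t) x = T s (T t x)" if "0 \<le> s" "0 \<le> t" "x \<in> carrier H" for s t x
      using that G.flow_law[of "emb H x" s t] emb_T[of t x] by (simp add: T_def)
    show "limitin (htopology H) (\<lambda>t. T t x) x (at_right 0)" if "x \<in> carrier H" for x
    proof (subst limitin_iff_emb)
      show "\<forall>\<^sub>F t in at_right 0. 0 < (t::real)" by (simp add: eventually_at_right_less)
      show "T t x \<in> carrier H" if "0 < t" for t using that T_in \<open>x \<in> carrier H\<close> by simp
      have "((\<lambda>t. emb H (T t x)) \<longlongrightarrow> emb H x) (at_right 0) \<longleftrightarrow>
          ((\<lambda>t. G.flow t (emb H x)) \<longlongrightarrow> emb H x) (at_right 0)"
        by (intro tendsto_cong eventually_mono[OF eventually_at_right_less]) (simp add: emb_T that)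
      then show "x \<in> carrier H \<and> ((\<lambda>t. emb H (T t x)) \<longlongrightarrow> emb H x) (at_right 0)"
        using that G.flow_continuous by simp
    qed
  qed
  moreover have lim_iff: "limitin (htopology H) (\<lambda>t. complex_of_real (1 / t) \<odot> (T t x \<ominus> x)) y (at_right 0) \<longleftrightarrow>
      y \<in> carrier H \<and> ((\<lambda>t. (1 / t) *\<^sub>R (G.flow t (emb H x) - emb H x)) \<longlongrightarrow> emb H y) (at_right 0)"
    if x: "x \<in> carrier H" for x y
  proof (subst limitin_iff_emb)
    show "\<forall>\<^sub>F t in at_right 0. 0 < (t::real)" by (simp add: eventually_at_right_less)
    show "complex_of_real (1 / t) \<odot> (T t x \<ominus> x) \<in> carrier H" if "0 < t" for t
      using that T_in x by simp
    have "((\<lambda>t. emb H (complex_of_real (1 / t) \<odot> (T t x \<ominus> x))) \<longlongrightarrow> emb H y) (at_right 0) \<longleftrightarrow>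
        ((\<lambda>t. (1 / t) *\<^sub>R (G.flow t (emb H x) - emb H x)) \<longlongrightarrow> emb H y) (at_right 0)"
      by (intro tendsto_cong eventually_mono[OF eventually_at_right_less])
        (use x T_in in \<open>simp add: emb_T emb_diff emb_scaleR del: of_real_divide\<close>)
    then show "y \<in> carrier H \<and> ((\<lambda>t. emb H (complex_of_real (1 / t) \<odot> (T t x \<ominus> x))) \<longlongrightarrow> emb H y) (at_right 0) \<longleftrightarrow>
        y \<in> carrier H \<and> ((\<lambda>t. (1 / t) *\<^sub>R (G.flow t (emb H x) - emb H x)) \<longlongrightarrow> emb H y) (at_right 0)"
      by simp
  qed
  have lim_B: "limitin (htopology H) (\<lambda>t. complex_of_real (1 / t) \<odot> (T t x \<ominus> x)) (B x) (at_right 0)"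
    if "x \<in> D" for x
    using that lim_iff[of x "B x"] DH B_in G.flow_derivative[of "emb H x"] by (simp add: BE)
  have lim_D: "x \<in> D" if "x \<in> carrier H"
    "limitin (htopology H) (\<lambda>t. complex_of_real (1 / t) \<odot> (T t x \<ominus> x)) y (at_right 0)" for x y
  proof -
    have "emb H x \<in> emb H ` D"
      using that lim_iff[of x y] by (intro G.flow_generator_maximal[of _ "emb H y"]) auto
    then show ?thesis using that(1) DH emb_eq_iff by blast
  qed
  have "is_generator H T D B"
    unfolding is_generator_def using lim_B lim_D DH by blast
  ultimately show ?thesis unfolding generates_contraction_semigroup_def by blast
qed

end

section \<open>Square-summable sequences in a Hilbert space\<close>

definition l2 :: "'a hilbert \<Rightarrow> (nat \<Rightarrow> 'a) hilbert"
  where "l2 H = \<lparr>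
    carrier = {f. (\<forall>n. f n \<in> carrier H) \<and> summable (\<lambda>n. (hnorm H (f n))\<^sup>2)},
    mult = (\<lambda>f g n. f n \<otimes>\<^bsub>H\<^esub> g n), one = (\<lambda>n. \<one>\<^bsub>H\<^esub>), zero = (\<lambda>n. \<zero>\<^bsub>H\<^esub>),
    add = (\<lambda>f g n. f n \<oplus>\<^bsub>H\<^esub> g n), smult = (\<lambda>c f n. c \<odot>\<^bsub>H\<^esub> f n),
    inner_prod = (\<lambda>f g. \<Sum>n. inner_prod H (f n) (g n))\<rparr>"

lemma l2_mem: "f \<in> carrier (l2 H) \<longleftrightarrow>
    (\<forall>n. f n \<in> carrier H) \<and> summable (\<lambda>n. (hnorm H (f n))\<^sup>2)"
  and l2_zero: "\<zero>\<^bsub>l2 H\<^esub> = (\<lambda>n. \<zero>\<^bsub>H\<^esub>)"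
  and l2_add: "f \<oplus>\<^bsub>l2 H\<^esub> g = (\<lambda>n. f n \<oplus>\<^bsub>H\<^esub> g n)"
  and l2_smult: "c \<odot>\<^bsub>l2 H\<^esub> f = (\<lambda>n. c \<odot>\<^bsub>H\<^esub> f n)"
  and l2_inner: "inner_prod (l2 H) f g = (\<Sum>n. inner_prod H (f n) (g n))"
  by (simp_all add: l2_def)

context complex_inner_product_space
begin

lemma l2_in: "f \<in> carrier (l2 H) \<Longrightarrow> f n \<in> carrier H"
  by (simp add: l2_mem)

lemma hnorm_zero: "hnorm H \<zero> = 0"
  by (simp add: hnorm_zero_iff)

lemma hnorm_add_square_le:
  assumes "x \<in> carrier H" "y \<in> carrier H"
  shows "(hnorm H (x \<oplus> y))\<^sup>2 \<le> 2 * (hnorm H x)\<^sup>2 + 2 * (hnorm H y)\<^sup>2"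
proof -
  have "(hnorm H (x \<oplus> y))\<^sup>2 \<le> (hnorm H x + hnorm H y)\<^sup>2"
    using assms by (intro power_mono hnorm_add_le hnorm_nonneg) auto
  also have "\<dots> \<le> 2 * (hnorm H x)\<^sup>2 + 2 * (hnorm H y)\<^sup>2"
    using zero_le_power2[of "hnorm H x - hnorm H y"] by (simp add: power2_eq_square algebra_simps)
  finally show ?thesis .
qed

lemma l2_add_closed:
  assumes "f \<in> carrier (l2 H)" "g \<in> carrier (l2 H)"
  shows "f \<oplus>\<^bsub>l2 H\<^esub> g \<in> carrier (l2 H)"
proof -
  have "summable (\<lambda>n. 2 * (hnorm H (f n))\<^sup>2 + 2 * (hnorm H (g n))\<^sup>2)"
    using assms by (intro summable_add summable_mult) (auto simp: l2_mem)
  then have "summable (\<lambda>n. (hnorm H (f n \<oplus> g n))\<^sup>2)"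
    by (rule summable_comparison_test') (use assms hnorm_add_square_le in \<open>auto simp: l2_mem\<close>)
  then show ?thesis using assms by (simp add: l2_mem l2_add)
qed

lemma l2_smult_closed:
  assumes "f \<in> carrier (l2 H)"
  shows "c \<odot>\<^bsub>l2 H\<^esub> f \<in> carrier (l2 H)"
  using assms by (simp add: l2_mem l2_smult hnorm_smult power_mult_distrib summable_mult)

lemma cmod_inner_le:
  assumes x: "x \<in> carrier H" and y: "y \<in> carrier H"
  shows "cmod (inner_prod H x y) \<le> (hnorm H x)\<^sup>2 + (hnorm H y)\<^sup>2"
proof -
  have "\<bar>Re (inner_prod H x y)\<bar> \<le> hnorm H x * hnorm H y"
    using x y by (rule abs_Re_inner_le)
  moreover have "\<bar>Im (inner_prod H x y)\<bar> \<le> hnorm H x * hnorm H y"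
    using abs_Re_inner_le[of "\<i> \<odot> x" y] x y by (simp add: inner_smult_left hnorm_smult)
  ultimately have "cmod (inner_prod H x y) \<le> 2 * hnorm H x * hnorm H y"
    using cmod_le[of "inner_prod H x y"] by simp
  then show ?thesis
    using sum_squares_bound[of "hnorm H x" "hnorm H y"] by simp
qed

lemma summable_inner:
  assumes "f \<in> carrier (l2 H)" "g \<in> carrier (l2 H)"
  shows "summable (\<lambda>n. inner_prod H (f n) (g n))"
proof -
  have "summable (\<lambda>n. (hnorm H (f n))\<^sup>2 + (hnorm H (g n))\<^sup>2)"
    using assms by (intro summable_add) (auto simp: l2_mem)
  then show ?thesis
    by (rule summable_comparison_test') (use assms cmod_inner_le l2_in in auto)
qed

lemma l2_inner_sums:
  assumes "f \<in> carrier (l2 H)" "g \<in> carrier (l2 H)"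
  shows "(\<lambda>n. inner_prod H (f n) (g n)) sums inner_prod (l2 H) f g"
  unfolding l2_inner by (rule summable_sums[OF summable_inner[OF assms]])

lemma l2_norm_sums:
  assumes "f \<in> carrier (l2 H)"
  shows "(\<lambda>n. (hnorm H (f n))\<^sup>2) sums Re (inner_prod (l2 H) f f)"
  using sums_Re[OF l2_inner_sums[OF assms assms]] assms by (simp add: hnorm_square l2_in)

lemma module_l2: "Module.module complex_field (l2 H)"
proof (rule moduleI)
  show "cring complex_field" by (rule R.is_cring)
  show "abelian_group (l2 H)"
  proof (rule abelian_groupI)
    show "\<zero>\<^bsub>l2 H\<^esub> \<in> carrier (l2 H)" by (simp add: l2_mem l2_zero hnorm_zero)
    show "\<exists>g\<in>carrier (l2 H). g \<oplus>\<^bsub>l2 H\<^esub> f = \<zero>\<^bsub>l2 H\<^esub>" if "f \<in> carrier (l2 H)" for f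
    proof (rule bexI[OF _ l2_smult_closed[OF that, of "-1"]])
      show "(- 1) \<odot>\<^bsub>l2 H\<^esub> f \<oplus>\<^bsub>l2 H\<^esub> f = \<zero>\<^bsub>l2 H\<^esub>"
        using l2_in[OF that] by (simp add: l2_smult l2_add l2_zero l_neg flip: minus_eq_smult)
    qed
  qed (auto simp: l2_add_closed, auto simp: l2_add l2_zero l2_in a_assoc a_comm a_lcomm)
qed (auto simp: l2_smult_closed, auto simp: l2_smult l2_add l2_in smult_r_distr smult_l_distr smult_assoc1)

lemma l2_inner_product_space: "complex_inner_product_space (l2 H)"
proof (rule complex_inner_product_space.intro[OF module_l2], unfold_locales)
  show "inner_prod (l2 H) (f \<oplus>\<^bsub>l2 H\<^esub> g) h = inner_prod (l2 H) f h + inner_prod (l2 H) g h"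
    if "f \<in> carrier (l2 H)" "g \<in> carrier (l2 H)" "h \<in> carrier (l2 H)" for f g h
  proof (rule sums_unique2[OF l2_inner_sums[OF l2_add_closed[OF that(1,2)] that(3)]])
    show "(\<lambda>n. inner_prod H ((f \<oplus>\<^bsub>l2 H\<^esub> g) n) (h n)) sums (inner_prod (l2 H) f h + inner_prod (l2 H) g h)"
      using sums_add[OF l2_inner_sums l2_inner_sums, of f h g h] that
      by (simp add: l2_add l2_in inner_add_left)
  qed
  show "inner_prod (l2 H) (c \<odot>\<^bsub>l2 H\<^esub> f) g = c * inner_prod (l2 H) f g"
    if "f \<in> carrier (l2 H)" "g \<in> carrier (l2 H)" for c f g
  proof (rule sums_unique2[OF l2_inner_sums[OF l2_smult_closed[OF that(1)] that(2)]])
    show "(\<lambda>n. inner_prod H ((c \<odot>\<^bsub>l2 H\<^esub> f) n) (g n)) sums (c * inner_prod (l2 H) f g)"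
      using sums_mult[OF l2_inner_sums, of f g c] that by (simp add: l2_smult l2_in inner_smult_left)
  qed
  show "inner_prod (l2 H) g f = cnj (inner_prod (l2 H) f g)"
    if "f \<in> carrier (l2 H)" "g \<in> carrier (l2 H)" for f g
  proof (rule sums_unique2[OF l2_inner_sums[OF that(2,1)]])
    have "inner_prod H (g n) (f n) = cnj (inner_prod H (f n) (g n))" for n
      using that by (intro inner_commute l2_in)
    then show "(\<lambda>n. inner_prod H (g n) (f n)) sums cnj (inner_prod (l2 H) f g)"
      using l2_inner_sums[OF that] by (simp add: sums_cnj)
  qed
  show "Re (inner_prod (l2 H) f f) > 0" if f: "f \<in> carrier (l2 H)" and "f \<noteq> \<zero>\<^bsub>l2 H\<^esub>" for f
  proof -
    obtain n where "f n \<noteq> \<zero>" using \<open>f \<noteq> _\<close> by (auto simp: l2_zero)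
    then have "0 < (hnorm H (f n))\<^sup>2" using f by (simp add: hnorm_zero_iff l2_in)
    then have "0 < (\<Sum>n. (hnorm H (f n))\<^sup>2)"
      using f by (intro suminf_pos2[of _ n]) (auto simp: l2_mem)
    then show ?thesis using sums_unique[OF l2_norm_sums[OF f]] by simp
  qed
qed

lemma l2_hnorm_sums:
  assumes "f \<in> carrier (l2 H)"
  shows "(\<lambda>n. (hnorm H (f n))\<^sup>2) sums (hnorm (l2 H) f)\<^sup>2"
  using l2_norm_sums[OF assms] assms
  by (simp add: complex_inner_product_space.hnorm_square[OF l2_inner_product_space])

lemma l2_minus:
  assumes "f \<in> carrier (l2 H)" "g \<in> carrier (l2 H)"
  shows "f \<ominus>\<^bsub>l2 H\<^esub> g = (\<lambda>n. f n \<ominus> g n)"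
proof -
  interpret Y: complex_inner_product_space "l2 H" by (rule l2_inner_product_space)
  show ?thesis using assms
    by (simp add: Y.minus_eq Y.minus_eq_smult minus_eq minus_eq_smult l2_in) (simp add: l2_add l2_smult)
qed

lemma hnorm_component_le:
  assumes "f \<in> carrier (l2 H)"
  shows "hnorm H (f n) \<le> hnorm (l2 H) f"
proof (rule power2_le_imp_le)
  have "(\<Sum>k\<in>{n}. (hnorm H (f k))\<^sup>2) \<le> (hnorm (l2 H) f)\<^sup>2"
    by (rule sum_le_suminf[OF sums_summable[OF l2_hnorm_sums[OF assms]], of "{n}",
        folded sums_unique[OF l2_hnorm_sums[OF assms]]]) auto
  then show "(hnorm H (f n))\<^sup>2 \<le> (hnorm (l2 H) f)\<^sup>2" by simp
  show "0 \<le> hnorm (l2 H) f"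
    using assms by (rule complex_inner_product_space.hnorm_nonneg[OF l2_inner_product_space])
qed

end

text \<open>
Completeness: a Cauchy sequence converges in each coordinate, and the Cauchy estimate passes to the
coordinatewise limit on every finite set of coordinates, hence to the whole series.
\<close>

lemma (in complex_hilbert_space) l2_hilbert_space: "complex_hilbert_space (l2 H)"
proof -
  interpret Y: complex_inner_product_space "l2 H" by (rule l2_inner_product_space)
  have "Metric_space.mcomplete (carrier (l2 H)) (hdist (l2 H))"
    unfolding Metric_space.mcomplete_def[OF Y.Metric_space_hdist]
  proof (intro allI impI)
    fix \<sigma> assume "Metric_space.MCauchy (carrier (l2 H)) (hdist (l2 H)) \<sigma>"
    then have range: "range \<sigma> \<subseteq> carrier (l2 H)"
      and cauchy': "\<forall>e>0. \<exists>N. \<forall>k l. N \<le> k \<longrightarrow> N \<le> l \<longrightarrow> hdist (l2 H) (\<sigma> k) (\<sigma> l) < e"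
      unfolding Metric_space.MCauchy_def[OF Y.Metric_space_hdist] by auto
    have \<sigma>: "\<sigma> k \<in> carrier (l2 H)" for k using range by auto
    have cauchy: "\<exists>N. \<forall>k\<ge>N. \<forall>l\<ge>N. hdist (l2 H) (\<sigma> k) (\<sigma> l) < e" if "0 < e" for e
      using cauchy'[rule_format, OF that] by auto
    have diff: "\<sigma> k \<ominus>\<^bsub>l2 H\<^esub> \<sigma> l \<in> carrier (l2 H)" for k l using \<sigma> by simp
    have "\<exists>x\<in>carrier H. (\<lambda>k. emb H (\<sigma> k n)) \<longlonglongrightarrow> emb H x" for n
    proof -
      have le: "dist (emb H (\<sigma> k n)) (emb H (\<sigma> l n)) \<le> hdist (l2 H) (\<sigma> k) (\<sigma> l)" for k l
        using hnorm_component_le[OF diff, of k l n] \<sigma> l2_in[OF \<sigma>]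
        by (simp add: dist_emb hdist_def l2_minus)
      have "Cauchy (\<lambda>k. emb H (\<sigma> k n))"
      proof (rule metric_CauchyI)
        fix e :: real assume "0 < e"
        from cauchy[OF this] obtain N where "\<forall>k\<ge>N. \<forall>l\<ge>N. hdist (l2 H) (\<sigma> k) (\<sigma> l) < e" by blast
        then have "\<forall>k\<ge>N. \<forall>l\<ge>N. dist (emb H (\<sigma> k n)) (emb H (\<sigma> l n)) < e"
          using le le_less_trans by blast
        then show "\<exists>N. \<forall>k\<ge>N. \<forall>l\<ge>N. dist (emb H (\<sigma> k n)) (emb H (\<sigma> l n)) < e" by blast
      qed
      then obtain u where u: "(\<lambda>k. emb H (\<sigma> k n)) \<longlonglongrightarrow> u"
        by (auto simp: Cauchy_convergent_iff convergent_def)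
      have "u \<in> emb H ` carrier H"
        by (rule closed_sequentially[OF closed_emb _ u]) (simp add: l2_in[OF \<sigma>])
      then show ?thesis using u by blast
    qed
    then obtain g where g: "\<And>n. g n \<in> carrier H" "\<And>n. (\<lambda>k. emb H (\<sigma> k n)) \<longlonglongrightarrow> emb H (g n)"
      by metis
    have tail: "(\<lambda>n. \<sigma> k n \<ominus> g n) \<in> carrier (l2 H) \<and> hnorm (l2 H) (\<lambda>n. \<sigma> k n \<ominus> g n) \<le> e"
      if e: "0 < e" and N: "\<forall>l\<ge>N. hdist (l2 H) (\<sigma> k) (\<sigma> l) < e" for e k N
    proof -
      have part: "(\<Sum>n<M. (hnorm H (\<sigma> k n \<ominus> g n))\<^sup>2) \<le> e\<^sup>2" for M
      proof (rule tendsto_upperbound)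
        show "(\<lambda>l. \<Sum>n<M. (norm (emb H (\<sigma> k n) - emb H (\<sigma> l n)))\<^sup>2) \<longlonglongrightarrow> (\<Sum>n<M. (hnorm H (\<sigma> k n \<ominus> g n))\<^sup>2)"
          using g l2_in[OF \<sigma>] by (auto simp: emb_diff simp flip: norm_emb intro!: tendsto_intros)
        show "\<forall>\<^sub>F l in sequentially. (\<Sum>n<M. (norm (emb H (\<sigma> k n) - emb H (\<sigma> l n)))\<^sup>2) \<le> e\<^sup>2"
          unfolding eventually_sequentially
        proof (intro exI allI impI)
          fix l assume "N \<le> l"
          then have le: "hnorm (l2 H) (\<sigma> k \<ominus>\<^bsub>l2 H\<^esub> \<sigma> l) \<le> e" using N \<sigma> by (force simp: hdist_def)
          have eq: "norm (emb H (\<sigma> k n) - emb H (\<sigma> l n)) = hnorm H ((\<sigma> k \<ominus>\<^bsub>l2 H\<^esub> \<sigma> l) n)" for n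
            using l2_in[OF \<sigma>] \<sigma> by (simp add: l2_minus norm_emb flip: emb_diff)
          have "(\<Sum>n<M. (norm (emb H (\<sigma> k n) - emb H (\<sigma> l n)))\<^sup>2) \<le> (hnorm (l2 H) (\<sigma> k \<ominus>\<^bsub>l2 H\<^esub> \<sigma> l))\<^sup>2"
            unfolding eq
            by (rule sum_le_suminf[OF sums_summable[OF l2_hnorm_sums[OF diff]], of "{..<M}",
                folded sums_unique[OF l2_hnorm_sums[OF diff]]]) auto
          also have "\<dots> \<le> e\<^sup>2" using le Y.hnorm_nonneg[OF diff] by (intro power_mono)
          finally show "(\<Sum>n<M. (norm (emb H (\<sigma> k n) - emb H (\<sigma> l n)))\<^sup>2) \<le> e\<^sup>2" .
        qed
      qed simp
      have "summable (\<lambda>n. (hnorm H (\<sigma> k n \<ominus> g n))\<^sup>2)"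
        using part by (intro summableI_nonneg_bounded) auto
      then have mem: "(\<lambda>n. \<sigma> k n \<ominus> g n) \<in> carrier (l2 H)"
        using g(1) l2_in[OF \<sigma>] by (simp add: l2_mem)
      have "(hnorm (l2 H) (\<lambda>n. \<sigma> k n \<ominus> g n))\<^sup>2 \<le> e\<^sup>2"
        unfolding sums_unique[OF l2_hnorm_sums[OF mem]]
        using part sums_summable[OF l2_hnorm_sums[OF mem]] by (intro suminf_le_const)
      then show ?thesis using mem e by (auto intro: power2_le_imp_le)
    qed
    have "g \<in> carrier (l2 H)"
    proof -
      obtain N where "\<forall>l\<ge>N. hdist (l2 H) (\<sigma> N) (\<sigma> l) < 1" using cauchy[of 1] by auto
      then have mem: "(\<lambda>n. \<sigma> N n \<ominus> g n) \<in> carrier (l2 H)" using tail[of 1 N N] by simp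
      have "\<sigma> N n \<ominus> (\<sigma> N n \<ominus> g n) = g n" for n
      proof -
        have "emb H (\<sigma> N n \<ominus> (\<sigma> N n \<ominus> g n)) = emb H (g n)"
          using g(1) l2_in[OF \<sigma>] by (simp add: emb_diff)
        then show ?thesis using g(1) l2_in[OF \<sigma>] by (simp add: emb_eq_iff)
      qed
      then have "g = \<sigma> N \<ominus>\<^bsub>l2 H\<^esub> (\<lambda>n. \<sigma> N n \<ominus> g n)" using \<sigma> mem by (simp add: l2_minus)
      then show ?thesis using Y.minus_closed[OF \<sigma>[of N] mem] by simp
    qed
    moreover have "\<exists>N. \<forall>k\<ge>N. hdist (l2 H) (\<sigma> k) g < e" if e: "0 < e" for e
    proof -
      obtain N where N: "\<forall>k\<ge>N. \<forall>l\<ge>N. hdist (l2 H) (\<sigma> k) (\<sigma> l) < e / 2" using cauchy[of "e/2"] e by auto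
      have "hdist (l2 H) (\<sigma> k) g < e" if "k \<ge> N" for k
        using tail[of "e/2" N k] N that e \<sigma> \<open>g \<in> carrier (l2 H)\<close> by (auto simp: hdist_def l2_minus)
      then show ?thesis by blast
    qed
    ultimately have "limitin (Metric_space.mtopology (carrier (l2 H)) (hdist (l2 H))) \<sigma> g sequentially"
      using \<sigma> by (simp add: Metric_space.limitin_metric[OF Y.Metric_space_hdist] eventually_sequentially)
    then show "\<exists>g. limitin (Metric_space.mtopology (carrier (l2 H)) (hdist (l2 H))) \<sigma> g sequentially"
      by blast
  qed
  then show ?thesis
    by unfold_locales (simp add: mcomplete_of_def Y.mspace_hmetric Y.mdist_hmetric)
qed

section \<open>The dilation of a closed dissipative operator\<close>

definition push :: "'a \<Rightarrow> (nat \<Rightarrow> 'a) \<Rightarrow> nat \<Rightarrow> 'a"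
  where "push a g n = (case n of 0 \<Rightarrow> a | Suc m \<Rightarrow> g m)"

lemma push_0 [simp]: "push a g 0 = a" and push_Suc [simp]: "push a g (Suc n) = g n"
  by (simp_all add: push_def)

lemma push_eqI: "f 0 = a \<Longrightarrow> (\<And>n. f (Suc n) = g n) \<Longrightarrow> f = push a g"
  by (rule ext) (simp add: push_def split: nat.split)

context complex_inner_product_space
begin

lemma push_closed:
  assumes "a \<in> carrier H" "g \<in> carrier (l2 H)" shows "push a g \<in> carrier (l2 H)"
proof -
  have "summable (\<lambda>n. (hnorm H (push a g (Suc n)))\<^sup>2)" using assms by (simp add: l2_mem)
  then have "summable (\<lambda>n. (hnorm H (push a g n))\<^sup>2)" by (simp only: summable_Suc_iff[of "\<lambda>n. (hnorm H (push a g n))\<^sup>2"])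
  moreover have "push a g n \<in> carrier H" for n using assms by (cases n) (auto simp: l2_mem)
  ultimately show ?thesis by (simp add: l2_mem)
qed

lemma tail_closed:
  assumes "f \<in> carrier (l2 H)" shows "(\<lambda>n. f (Suc n)) \<in> carrier (l2 H)"
  using assms summable_Suc_iff[of "\<lambda>n. (hnorm H (f n))\<^sup>2"] by (simp add: l2_mem)

lemma inner_push:
  assumes "a \<in> carrier H" "g \<in> carrier (l2 H)" "f \<in> carrier (l2 H)"
  shows "inner_prod (l2 H) (push a g) f = inner_prod H a (f 0) + inner_prod (l2 H) g (\<lambda>n. f (Suc n))"
  using suminf_split_head[OF summable_inner[OF push_closed[OF assms(1,2)] assms(3)]]
  by (simp add: l2_inner)

lemma push_add: "push a g \<oplus>\<^bsub>l2 H\<^esub> push b h = push (a \<oplus> b) (g \<oplus>\<^bsub>l2 H\<^esub> h)"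
  by (rule push_eqI) (simp_all add: l2_add)

lemma push_smult: "c \<odot>\<^bsub>l2 H\<^esub> push a g = push (c \<odot> a) (c \<odot>\<^bsub>l2 H\<^esub> g)"
  by (rule push_eqI) (simp_all add: l2_smult)

end

locale closed_dissipative_operator = complex_hilbert_space H for H :: "'a hilbert" (structure) +
  fixes DA :: "'a set" and A :: "'a \<Rightarrow> 'a"
  assumes linear_A: "linear_operator H DA A"
    and closed_A: "closed_operator H DA A"
    and dissipative_A: "dissipative H DA A"
begin

sublocale Y: complex_hilbert_space "l2 H" by (rule l2_hilbert_space)

lemma submodule_DA: "submodule DA complex_field H"
  using linear_A by (simp add: linear_operator_def)

lemmas DA = submoduleD[OF submodule_DA]

lemma DA_in: "x \<in> DA \<Longrightarrow> x \<in> carrier H" using DA(1) by blast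

lemma A_in: "x \<in> DA \<Longrightarrow> A x \<in> carrier H"
  and A_add: "x \<in> DA \<Longrightarrow> y \<in> DA \<Longrightarrow> A (x \<oplus> y) = A x \<oplus> A y"
  and A_smult: "x \<in> DA \<Longrightarrow> A (c \<odot> x) = c \<odot> A x"
  using linear_A by (auto simp: linear_operator_def)

lemma A_zero: "A \<zero> = \<zero>"
  using A_smult[OF DA(2), of 0] smult_l_null[OF zero_closed] smult_l_null[OF A_in[OF DA(2)]]
  by (simp add: complex_field_def)

definition range_I_minus :: "'a set" where "range_I_minus = (\<lambda>x. x \<ominus> A x) ` DA"

lemma range_in: "range_I_minus \<subseteq> carrier H" using DA_in A_in by (auto simp: range_I_minus_def)

lemma submodule_range: "submodule range_I_minus complex_field H"
proof (rule submodule_criterion[OF range_in])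
  have "\<ominus> \<zero> = \<zero>" by (rule minus_equality) simp_all
  then have "\<zero> = \<zero> \<ominus> A \<zero>" by (simp only: A_zero minus_eq l_zero zero_closed)
  then show "\<zero> \<in> range_I_minus" unfolding range_I_minus_def using DA(2) by (rule image_eqI)
  show "u \<oplus> v \<in> range_I_minus" if uv: "u \<in> range_I_minus" "v \<in> range_I_minus" for u v
  proof -
    obtain x y where xy: "x \<in> DA" "y \<in> DA" "u = x \<ominus> A x" "v = y \<ominus> A y" using uv by (auto simp: range_I_minus_def)
    have "emb H (u \<oplus> v) = emb H ((x \<oplus> y) \<ominus> A (x \<oplus> y))"
      using xy DA_in A_in by (simp add: emb_add emb_diff A_add)
    then have "u \<oplus> v = (x \<oplus> y) \<ominus> A (x \<oplus> y)"
      using xy DA_in A_in by (simp add: emb_eq_iff A_add)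
    then show ?thesis using xy DA(3) by (auto simp: range_I_minus_def)
  qed
  show "c \<odot> u \<in> range_I_minus" if u: "u \<in> range_I_minus" for c u
    using u DA(4) DA_in A_in by (auto simp: range_I_minus_def smult_diff simp flip: A_smult)
qed

lemma hnorm_le_diff:
  assumes "x \<in> DA" shows "hnorm H x \<le> hnorm H (x \<ominus> A x)"
  using norm_le_dissipative[of x "A x" 1] assms dissipative_A DA_in A_in
  by (simp add: dissipative_def norm_emb flip: emb_diff)

text \<open>
If \<open>x\<^sub>n - A x\<^sub>n\<close> converges, then \<open>x\<^sub>n\<close> is Cauchy because \<open>I - A\<close> does not decrease norms; so \<open>A x\<^sub>n\<close>
converges as well, and the graph of \<open>A\<close> is closed.
\<close>

lemma closed_range: "closedin (htopology H) range_I_minus"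
proof -
  have "closed (emb H ` range_I_minus)"
    unfolding closed_sequential_limits
  proof (intro allI impI, elim conjE)
    fix u l assume u: "\<forall>n. u n \<in> emb H ` range_I_minus" "u \<longlonglongrightarrow> l"
    then have "\<exists>x. x \<in> DA \<and> u n = emb H (x \<ominus> A x)" for n by (auto simp: range_I_minus_def)
    then obtain \<sigma> where \<sigma>: "\<And>n. \<sigma> n \<in> DA" "\<And>n. u n = emb H (\<sigma> n \<ominus> A (\<sigma> n))" by metis
    have u_eq: "u n = emb H (\<sigma> n) - emb H (A (\<sigma> n))" for n
      using \<sigma> DA_in A_in by (simp add: emb_diff)
    have "dist (emb H (\<sigma> m)) (emb H (\<sigma> n)) \<le> dist (u m) (u n)" for m n
    proof -
      define x where "x = \<sigma> m \<oplus> (- 1) \<odot> \<sigma> n"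
      have x: "x \<in> DA" using \<sigma>(1) DA by (simp add: x_def)
      have e: "emb H (c \<oplus> (- 1) \<odot> d) = emb H c - emb H d" if "c \<in> carrier H" "d \<in> carrier H" for c d
        using that by (simp add: emb_diff flip: minus_eq_smult minus_eq)
      have Ax: "A x = A (\<sigma> m) \<oplus> (- 1) \<odot> A (\<sigma> n)"
        using \<sigma>(1) DA by (simp add: x_def A_add A_smult)
      have "norm (emb H x) \<le> norm (emb H x - emb H (A x))"
        using hnorm_le_diff[OF x] x DA_in A_in by (simp add: norm_emb flip: emb_diff)
      also have "emb H x - emb H (A x) = u m - u n"
        unfolding Ax u_eq using \<sigma>(1) DA_in A_in by (simp add: x_def e)
      finally show ?thesis using \<sigma>(1) DA_in by (simp add: dist_norm x_def e)
    qed
    moreover have "Cauchy u" using u(2) LIMSEQ_imp_Cauchy by blast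
    ultimately have "Cauchy (\<lambda>n. emb H (\<sigma> n))"
      unfolding Cauchy_def by (meson le_less_trans)
    then obtain v where v: "(\<lambda>n. emb H (\<sigma> n)) \<longlonglongrightarrow> v" by (auto simp: Cauchy_convergent_iff convergent_def)
    have "v \<in> emb H ` carrier H"
      by (rule closed_sequentially[OF closed_emb _ v]) (simp add: \<sigma> DA_in)
    then obtain x where x: "x \<in> carrier H" "v = emb H x" by blast
    have "(\<lambda>n. emb H (\<sigma> n) - u n) \<longlonglongrightarrow> v - l" by (intro tendsto_diff v u)
    then have w: "(\<lambda>n. emb H (A (\<sigma> n))) \<longlonglongrightarrow> v - l" by (simp add: u_eq)
    have "v - l \<in> emb H ` carrier H"
      by (rule closed_sequentially[OF closed_emb _ w]) (simp add: \<sigma> A_in)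
    then obtain y where y: "y \<in> carrier H" "v - l = emb H y" by blast
    have "limitin (prod_topology (htopology H) (htopology H)) (\<lambda>n. (\<sigma> n, A (\<sigma> n))) (x, y) sequentially"
      using x y v w \<sigma>(1) DA_in A_in
        limitin_iff_emb[of "\<lambda>_. True" \<sigma> sequentially x]
        limitin_iff_emb[of "\<lambda>_. True" "\<lambda>n. A (\<sigma> n)" sequentially y]
      by (simp add: limitin_pairwise o_def)
    then have "(x, y) \<in> (\<lambda>x. (x, A x)) ` DA"
      using closed_A[unfolded closed_operator_def]
      by (rule limitin_closedin) (use \<sigma>(1) in auto)
    then have "x \<in> DA" "y = A x" by auto
    then have "l = emb H (x \<ominus> A x)"
      using x y DA_in A_in by (simp add: emb_diff algebra_simps)
    then show "l \<in> emb H ` range_I_minus" using \<open>x \<in> DA\<close> by (auto simp: range_I_minus_def)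
  qed
  then show ?thesis using closed_emb_image[OF range_in complete] by simp
qed

text \<open>
The sequences on which the shift part of the dilation acts: they start in the orthogonal complement
of the range of \<open>I - A\<close>.
\<close>

definition defect_seqs :: "(nat \<Rightarrow> 'a) set"
  where "defect_seqs = {g \<in> carrier (l2 H). \<forall>m\<in>range_I_minus. inner_prod H (g 0) m = 0}"

text \<open>
The inverse Cayley transform of the contraction
\<open>(a - A a + 2 g 0, 2 g 1, 2 g 2, ...) \<mapsto> (a + A a, 2 g 0, 2 g 1, ...)\<close>: with \<open>y\<close> and \<open>z\<close> as below, the left
side is \<open>y - z\<close> and the right side is \<open>y + z\<close>.
\<close>

definition dilation_graph :: "(nat \<Rightarrow> 'a) \<Rightarrow> (nat \<Rightarrow> 'a) \<Rightarrow> bool"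
  where "dilation_graph y z \<longleftrightarrow> (\<exists>a\<in>DA. \<exists>g\<in>defect_seqs. y = push a g \<oplus>\<^bsub>l2 H\<^esub> g \<and> z = push (A a) g \<ominus>\<^bsub>l2 H\<^esub> g)"

definition dilation_dom :: "(nat \<Rightarrow> 'a) set" where "dilation_dom = {y. \<exists>z. dilation_graph y z}"

definition dilation :: "(nat \<Rightarrow> 'a) \<Rightarrow> nat \<Rightarrow> 'a" where "dilation y = (THE z. dilation_graph y z)"

lemma defect_seqs_in: "g \<in> defect_seqs \<Longrightarrow> g \<in> carrier (l2 H)" by (simp add: defect_seqs_def)

lemma defect_seqs_zero: "\<zero>\<^bsub>l2 H\<^esub> \<in> defect_seqs"
proof -
  have "(\<zero>\<^bsub>l2 H\<^esub>) 0 = \<zero>" by (simp add: l2_zero)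
  then show ?thesis using range_in by (auto simp: defect_seqs_def inner_zero_left)
qed

lemma defect_seqs_add: "g \<in> defect_seqs \<Longrightarrow> h \<in> defect_seqs \<Longrightarrow> g \<oplus>\<^bsub>l2 H\<^esub> h \<in> defect_seqs"
  using range_in by (auto simp: defect_seqs_def l2_add_closed) (auto simp: l2_add inner_add_left l2_in subset_eq)

lemma defect_seqs_smult: "g \<in> defect_seqs \<Longrightarrow> c \<odot>\<^bsub>l2 H\<^esub> g \<in> defect_seqs"
  using range_in by (auto simp: defect_seqs_def l2_smult_closed) (auto simp: l2_smult inner_smult_left l2_in subset_eq)

text \<open>
From the first coordinate on, the equation says that the coordinates of \<open>g - h\<close> alternate in sign, so
they have constant norm; being square-summable, they vanish.
\<close>

lemma push_add_inject:
  assumes ab: "a \<in> carrier H" "b \<in> carrier H" and gh: "g \<in> carrier (l2 H)" "h \<in> carrier (l2 H)"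
    and eq: "push a g \<oplus>\<^bsub>l2 H\<^esub> g = push b h \<oplus>\<^bsub>l2 H\<^esub> h"
  shows "a = b" "g = h"
proof -
  define d where "d = (\<lambda>n. emb H (g n) - emb H (h n))"
  have comp: "push a g n \<oplus> g n = push b h n \<oplus> h n" for n
    using fun_cong[OF eq, of n] by (simp add: l2_add)
  have "d (Suc n) = - d n" for n
  proof -
    have "emb H (g n \<oplus> g (Suc n)) = emb H (h n \<oplus> h (Suc n))" using comp[of "Suc n"] by simp
    then show ?thesis using gh by (simp add: d_def emb_add l2_in algebra_simps)
  qed
  then have const: "norm (d n) = norm (d 0)" for n by (induction n) auto
  have "g \<ominus>\<^bsub>l2 H\<^esub> h \<in> carrier (l2 H)" using gh by simp
  then have "summable (\<lambda>n. (hnorm H (g n \<ominus> h n))\<^sup>2)" using gh by (simp add: l2_mem l2_minus)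
  moreover have "hnorm H (g n \<ominus> h n) = norm (d n)" for n
    using gh by (simp add: d_def l2_in norm_emb flip: emb_diff)
  then have "hnorm H (g n \<ominus> h n) = norm (d 0)" for n using const[of n] by simp
  ultimately have "summable (\<lambda>n::nat. (norm (d 0))\<^sup>2)" by simp
  then have "norm (d 0) = 0" by (simp add: summable_const_iff)
  then have "d n = 0" for n using const[of n] by simp
  then have "emb H (g n) = emb H (h n)" for n by (simp add: d_def)
  then show "g = h" using gh by (auto simp: emb_eq_iff l2_in)
  then have "emb H a + emb H (g 0) = emb H b + emb H (g 0)"
    using comp[of 0] ab gh by (simp add: l2_in flip: emb_add)
  then show "a = b" using ab by (simp add: emb_eq_iff)
qed

lemma dilation_eq:
  assumes "a \<in> DA" "g \<in> defect_seqs"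
  shows "push a g \<oplus>\<^bsub>l2 H\<^esub> g \<in> dilation_dom" "dilation (push a g \<oplus>\<^bsub>l2 H\<^esub> g) = push (A a) g \<ominus>\<^bsub>l2 H\<^esub> g"
proof -
  have *: "dilation_graph (push a g \<oplus>\<^bsub>l2 H\<^esub> g) (push (A a) g \<ominus>\<^bsub>l2 H\<^esub> g)"
    using assms by (auto simp: dilation_graph_def)
  then show "push a g \<oplus>\<^bsub>l2 H\<^esub> g \<in> dilation_dom" by (auto simp: dilation_dom_def)
  show "dilation (push a g \<oplus>\<^bsub>l2 H\<^esub> g) = push (A a) g \<ominus>\<^bsub>l2 H\<^esub> g"
    unfolding dilation_def
  proof (rule the_equality[of "dilation_graph _", OF *])
    fix z assume "dilation_graph (push a g \<oplus>\<^bsub>l2 H\<^esub> g) z"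
    then obtain b h where bh: "b \<in> DA" "h \<in> defect_seqs" "push a g \<oplus>\<^bsub>l2 H\<^esub> g = push b h \<oplus>\<^bsub>l2 H\<^esub> h"
      "z = push (A b) h \<ominus>\<^bsub>l2 H\<^esub> h" unfolding dilation_graph_def by blast
    have "a = b" "g = h"
      using push_add_inject[OF DA_in DA_in defect_seqs_in defect_seqs_in bh(3)] assms bh by auto
    then show "z = push (A a) g \<ominus>\<^bsub>l2 H\<^esub> g" using bh by simp
  qed
qed

lemma dilation_dom_cases:
  assumes "y \<in> dilation_dom"
  obtains a g where "a \<in> DA" "g \<in> defect_seqs" "y = push a g \<oplus>\<^bsub>l2 H\<^esub> g" "dilation y = push (A a) g \<ominus>\<^bsub>l2 H\<^esub> g"
proof -
  obtain z where "dilation_graph y z" using assms by (auto simp: dilation_dom_def)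
  then obtain a g where "a \<in> DA" "g \<in> defect_seqs" "y = push a g \<oplus>\<^bsub>l2 H\<^esub> g" unfolding dilation_graph_def by blast
  then show thesis using that dilation_eq(2) by blast
qed

lemma linear_dilation: "linear_operator (l2 H) dilation_dom dilation"
proof -
  have add: "y \<oplus>\<^bsub>l2 H\<^esub> z \<in> dilation_dom \<and> dilation (y \<oplus>\<^bsub>l2 H\<^esub> z) = dilation y \<oplus>\<^bsub>l2 H\<^esub> dilation z" if yz: "y \<in> dilation_dom" "z \<in> dilation_dom" for y z
  proof -
    obtain a g where ag: "a \<in> DA" "g \<in> defect_seqs" "y = push a g \<oplus>\<^bsub>l2 H\<^esub> g" "dilation y = push (A a) g \<ominus>\<^bsub>l2 H\<^esub> g"
      using yz(1) by (rule dilation_dom_cases)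
    obtain b h where bh: "b \<in> DA" "h \<in> defect_seqs" "z = push b h \<oplus>\<^bsub>l2 H\<^esub> h" "dilation z = push (A b) h \<ominus>\<^bsub>l2 H\<^esub> h"
      using yz(2) by (rule dilation_dom_cases)
    note mem = ag(1,2) bh(1,2) DA_in A_in defect_seqs_in push_closed
    define gh where "gh = g \<oplus>\<^bsub>l2 H\<^esub> h"
    have p: "push (a \<oplus> b) gh = push a g \<oplus>\<^bsub>l2 H\<^esub> push b h"
      "push (A a \<oplus> A b) gh = push (A a) g \<oplus>\<^bsub>l2 H\<^esub> push (A b) h"
      by (simp_all add: gh_def push_add)
    have 1: "emb (l2 H) (y \<oplus>\<^bsub>l2 H\<^esub> z) = emb (l2 H) (push (a \<oplus> b) gh \<oplus>\<^bsub>l2 H\<^esub> gh)"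
      unfolding p ag(3) bh(3) unfolding gh_def using mem by (simp add: Y.emb_add)
    have 2: "emb (l2 H) (dilation y \<oplus>\<^bsub>l2 H\<^esub> dilation z) = emb (l2 H) (push (A a \<oplus> A b) gh \<ominus>\<^bsub>l2 H\<^esub> gh)"
      unfolding p ag(4) bh(4) unfolding gh_def using mem by (simp add: Y.emb_add Y.emb_diff)
    have "y \<oplus>\<^bsub>l2 H\<^esub> z = push (a \<oplus> b) gh \<oplus>\<^bsub>l2 H\<^esub> gh"
      using 1 mem by (subst (asm) Y.emb_eq_iff) (auto simp: ag(3) bh(3) gh_def)
    moreover have "dilation y \<oplus>\<^bsub>l2 H\<^esub> dilation z = push (A a \<oplus> A b) gh \<ominus>\<^bsub>l2 H\<^esub> gh"
      using 2 mem by (subst (asm) Y.emb_eq_iff) (auto simp: ag(4) bh(4) gh_def)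
    ultimately show ?thesis
      using dilation_eq[OF DA(3)[OF ag(1) bh(1)], of gh] defect_seqs_add ag bh by (simp add: A_add gh_def)
  qed
  have smult: "c \<odot>\<^bsub>l2 H\<^esub> y \<in> dilation_dom \<and> dilation (c \<odot>\<^bsub>l2 H\<^esub> y) = c \<odot>\<^bsub>l2 H\<^esub> dilation y" if y: "y \<in> dilation_dom" for c y
  proof -
    obtain a g where ag: "a \<in> DA" "g \<in> defect_seqs" "y = push a g \<oplus>\<^bsub>l2 H\<^esub> g" "dilation y = push (A a) g \<ominus>\<^bsub>l2 H\<^esub> g"
      using y by (rule dilation_dom_cases)
    note mem = ag(1,2) DA_in A_in defect_seqs_in push_closed
    have "c \<odot>\<^bsub>l2 H\<^esub> y = push (c \<odot> a) (c \<odot>\<^bsub>l2 H\<^esub> g) \<oplus>\<^bsub>l2 H\<^esub> (c \<odot>\<^bsub>l2 H\<^esub> g)"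
      unfolding ag(3) push_smult[symmetric] using mem by (simp add: Y.smult_r_distr)
    moreover have "c \<odot>\<^bsub>l2 H\<^esub> dilation y = push (c \<odot> A a) (c \<odot>\<^bsub>l2 H\<^esub> g) \<ominus>\<^bsub>l2 H\<^esub> (c \<odot>\<^bsub>l2 H\<^esub> g)"
      unfolding ag(4) push_smult[symmetric] using mem by (simp add: Y.smult_diff)
    ultimately show ?thesis
      using dilation_eq[OF DA(4)[OF ag(1)] defect_seqs_smult[OF ag(2)], of c c] ag(1) by (simp add: A_smult)
  qed
  have in_l2: "y \<in> carrier (l2 H)" "dilation y \<in> carrier (l2 H)" if "y \<in> dilation_dom" for y
    using that DA_in A_in defect_seqs_in push_closed by (auto elim!: dilation_dom_cases)
  then have dom_in: "dilation_dom \<subseteq> carrier (l2 H)" by blast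
  have zero: "\<zero>\<^bsub>l2 H\<^esub> \<in> dilation_dom"
  proof -
    obtain y where "y \<in> dilation_dom" using dilation_eq(1)[OF DA(2) defect_seqs_zero] by blast
    then show ?thesis
      using smult[of y 0] dom_in Y.smult_l_null[of y] by (auto simp: complex_field_def)
  qed
  have "dilation \<in> dilation_dom \<rightarrow> carrier (l2 H)"
    using in_l2(2) by blast
  moreover have "submodule dilation_dom complex_field (l2 H)"
    using dom_in zero add smult by (intro Y.submodule_criterion) auto
  ultimately show ?thesis using add smult by (simp add: linear_operator_def)
qed

text \<open>
Pairing \<open>push (A a) g - g\<close> with \<open>push a g + g\<close>, the squared norms of \<open>g\<close> cancel because \<open>push\<close> preserves
them. The mixed terms are \<open>Re \<langle>A a - a, g 0\<rangle>\<close> plus the difference of two conjugate numbers, and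
\<open>g 0\<close> is orthogonal to \<open>a - A a\<close>. Only \<open>Re \<langle>A a, a\<rangle>\<close> remains.
\<close>

lemma dissipative_dilation: "dissipative (l2 H) dilation_dom dilation"
  unfolding dissipative_def
proof
  fix y assume "y \<in> dilation_dom"
  then obtain a g where ag: "a \<in> DA" "g \<in> defect_seqs" "y = push a g \<oplus>\<^bsub>l2 H\<^esub> g" "dilation y = push (A a) g \<ominus>\<^bsub>l2 H\<^esub> g"
    by (rule dilation_dom_cases)
  note mem = ag(1,2) DA_in[OF ag(1)] A_in[OF ag(1)] defect_seqs_in[OF ag(2)] l2_in[OF defect_seqs_in[OF ag(2)], of 0]
  note tail = tail_closed[OF defect_seqs_in[OF ag(2)]]
  have "inner_prod H (g 0) (a \<ominus> A a) = 0" using ag by (auto simp: defect_seqs_def range_I_minus_def)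
  then have orth: "inner_prod H (g 0) (A a) = inner_prod H (g 0) a"
    using mem by (simp add: inner_diff_right)
  have 1: "inner_prod (l2 H) (push (A a) g) (push a g) = inner_prod H (A a) a + inner_prod (l2 H) g g"
    using mem by (simp add: inner_push push_closed)
  have 2: "inner_prod (l2 H) (push (A a) g) g = inner_prod H (A a) (g 0) + inner_prod (l2 H) g (\<lambda>n. g (Suc n))"
    using mem by (simp add: inner_push)
  have 3: "inner_prod (l2 H) (push a g) g = inner_prod H a (g 0) + inner_prod (l2 H) g (\<lambda>n. g (Suc n))"
    using mem by (simp add: inner_push)
  have "Re (inner_prod H (A a) (g 0)) = Re (inner_prod H a (g 0))"
    using orth mem by (simp add: Re_inner_commute[of "g 0" "A a"] Re_inner_commute[of "g 0" a])
  then have 4: "Re (inner_prod (l2 H) (push (A a) g) g) = Re (inner_prod (l2 H) g (push a g))"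
    using mem by (simp add: 2 3 Y.Re_inner_commute[of "push a g" g] push_closed)
  have "Re (inner_prod (l2 H) (dilation y) y) = Re (inner_prod H (A a) a)"
    unfolding ag(4) unfolding ag(3) using mem 4
    by (simp add: push_closed Y.inner_diff_left Y.inner_add_right 1)
  also have "\<dots> \<le> 0" using dissipative_A ag(1) by (simp add: dissipative_def)
  finally show "Re (inner_prod (l2 H) (dilation y) y) \<le> 0" .
qed

text \<open>
Here \<open>y - B y = (a - A a + 2 g 0, 2 g 1, 2 g 2, ...)\<close>, so \<open>a\<close> and \<open>g 0\<close> are read off from the orthogonal
decomposition of \<open>f 0\<close>, and the rest of \<open>g\<close> is half of \<open>f\<close>.
\<close>

lemma onto_dilation:
  assumes f: "f \<in> carrier (l2 H)"
  shows "\<exists>y\<in>dilation_dom. y \<ominus>\<^bsub>l2 H\<^esub> dilation y = f"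
proof -
  obtain p where p: "p \<in> range_I_minus" "\<And>m. m \<in> range_I_minus \<Longrightarrow> inner_prod H (f 0 \<ominus> p) m = 0"
    using orthogonal_decomposition[OF submodule_range closed_range l2_in[OF f, of 0]] by blast
  then obtain a where a: "a \<in> DA" "p = a \<ominus> A a" by (auto simp: range_I_minus_def)
  have pH: "p \<in> carrier H" using p(1) range_in by blast
  define q where "q = f 0 \<ominus> p"
  have qH: "q \<in> carrier H" using f pH by (simp add: q_def l2_in)
  define g where "g = complex_of_real (1/2) \<odot>\<^bsub>l2 H\<^esub> push q (\<lambda>n. f (Suc n))"
  have gY: "g \<in> carrier (l2 H)"
    unfolding g_def by (intro l2_smult_closed push_closed tail_closed f qH)
  have g0: "g 0 = complex_of_real (1/2) \<odot> q" and gS: "g (Suc n) = complex_of_real (1/2) \<odot> f (Suc n)" for n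
    by (simp_all add: g_def l2_smult)
  have gK: "g \<in> defect_seqs"
    using gY p(2) range_in qH by (auto simp: defect_seqs_def g0 inner_smult_left q_def[symmetric] subset_eq)
  define y where "y = push a g \<oplus>\<^bsub>l2 H\<^esub> g"
  have y: "y \<in> dilation_dom" "dilation y = push (A a) g \<ominus>\<^bsub>l2 H\<^esub> g" using dilation_eq[OF a(1) gK] by (auto simp: y_def)
  note mem = DA_in[OF a(1)] A_in[OF a(1)] gY l2_in[OF gY] l2_in[OF f] qH pH
  have emb_eq: "emb H ((push a g n \<oplus> g n) \<ominus> (push (A a) g n \<ominus> g n)) = emb H (f n)" for n
  proof (cases n)
    case 0
    have "emb H (f 0) = emb H q + (emb H a - emb H (A a))"
      using mem by (simp add: q_def emb_diff flip: a(2)) (simp add: a(2) emb_diff mem)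
    then show ?thesis
      using mem unfolding 0 by (simp add: emb_add emb_diff)
        (simp add: g0 emb_scaleR mem flip: scaleR_add_left del: of_real_divide)
  next
    case (Suc m)
    show ?thesis
      using mem unfolding Suc by (simp add: emb_add emb_diff)
        (simp add: gS emb_scaleR mem flip: scaleR_add_left del: of_real_divide)
  qed
  have "(push a g n \<oplus> g n) \<ominus> (push (A a) g n \<ominus> g n) = f n" for n
    using emb_eq[of n] mem l2_in[OF push_closed[OF mem(1,3)], of n] l2_in[OF push_closed[OF mem(2,3)], of n]
    by (simp add: emb_eq_iff)
  moreover have "y \<ominus>\<^bsub>l2 H\<^esub> dilation y = (\<lambda>n. (push a g n \<oplus> g n) \<ominus> (push (A a) g n \<ominus> g n))"
  proof -
    have "y \<in> carrier (l2 H)" "dilation y \<in> carrier (l2 H)"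
      using mem push_closed by (simp_all add: y(2)) (simp add: y_def)
    then have "y \<ominus>\<^bsub>l2 H\<^esub> dilation y = (\<lambda>n. y n \<ominus> dilation y n)" by (rule l2_minus)
    then show ?thesis
      using mem push_closed by (simp add: y(2) l2_minus) (simp add: y_def l2_add)
  qed
  ultimately have "y \<ominus>\<^bsub>l2 H\<^esub> dilation y = f" by simp
  then show ?thesis using y(1) by blast
qed

theorem dilation_generates: "generates_contraction_semigroup (l2 H) dilation_dom dilation"
  by (rule Y.lumer_phillips[OF linear_dilation dissipative_dilation onto_dilation])

definition at_head :: "'a \<Rightarrow> nat \<Rightarrow> 'a" where "at_head x = push x \<zero>\<^bsub>l2 H\<^esub>"

lemma at_head_in: "x \<in> carrier H \<Longrightarrow> at_head x \<in> carrier (l2 H)"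
  by (simp add: at_head_def push_closed)

lemma at_head_add: "x \<in> carrier H \<Longrightarrow> y \<in> carrier H \<Longrightarrow> at_head (x \<oplus> y) = at_head x \<oplus>\<^bsub>l2 H\<^esub> at_head y"
  by (simp add: at_head_def push_add)

lemma at_head_smult: "x \<in> carrier H \<Longrightarrow> at_head (c \<odot> x) = c \<odot>\<^bsub>l2 H\<^esub> at_head x"
  by (simp add: at_head_def push_smult)

lemma hnorm_at_head: "x \<in> carrier H \<Longrightarrow> hnorm (l2 H) (at_head x) = hnorm H x"
  by (simp add: hnorm_def at_head_def inner_push push_closed Y.inner_zero_left flip: l2_zero)

lemma at_head_diff: "x \<in> carrier H \<Longrightarrow> y \<in> carrier H \<Longrightarrow> at_head (x \<ominus> y) = at_head x \<ominus>\<^bsub>l2 H\<^esub> at_head y"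
  by (simp add: minus_eq minus_eq_smult Y.minus_eq Y.minus_eq_smult at_head_add at_head_smult at_head_in)

lemma isometric_embedding_at_head: "isometric_embedding H (l2 H) at_head"
  unfolding isometric_embedding_def
proof (intro conjI ballI allI)
  show "at_head \<in> carrier H \<rightarrow> carrier (l2 H)" using at_head_in by blast
  have sub: "at_head ` carrier H \<subseteq> carrier (l2 H)" using at_head_in by blast
  have dist: "dist (emb (l2 H) (at_head x)) (emb (l2 H) (at_head y)) = dist (emb H x) (emb H y)"
    if "x \<in> carrier H" "y \<in> carrier H" for x y
    using that by (simp add: dist_norm norm_emb Y.norm_emb at_head_in hnorm_at_head flip: emb_diff Y.emb_diff at_head_diff)
  have "closed (emb (l2 H) ` at_head ` carrier H)"
    unfolding closed_sequential_limits
  proof (intro allI impI, elim conjE)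
    fix u l assume u: "\<forall>n. u n \<in> emb (l2 H) ` at_head ` carrier H" "u \<longlonglongrightarrow> l"
    then have "\<exists>x. x \<in> carrier H \<and> u n = emb (l2 H) (at_head x)" for n by auto
    then obtain \<sigma> where \<sigma>: "\<And>n. \<sigma> n \<in> carrier H" "\<And>n. u n = emb (l2 H) (at_head (\<sigma> n))" by metis
    have "Cauchy u" using u(2) LIMSEQ_imp_Cauchy by blast
    then have "Cauchy (\<lambda>n. emb H (\<sigma> n))"
      unfolding Cauchy_def \<sigma>(2) by (simp add: dist \<sigma>(1))
    then obtain v where v: "(\<lambda>n. emb H (\<sigma> n)) \<longlonglongrightarrow> v" by (auto simp: Cauchy_convergent_iff convergent_def)
    have "v \<in> emb H ` carrier H"
      by (rule closed_sequentially[OF closed_emb _ v]) (simp add: \<sigma>(1))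
    then obtain x where x: "x \<in> carrier H" "v = emb H x" by blast
    have "u \<longlonglongrightarrow> emb (l2 H) (at_head x)"
      using v unfolding tendsto_dist_iff[of _ v] tendsto_dist_iff[of u] by (simp add: \<sigma> x dist)
    then have "l = emb (l2 H) (at_head x)" using u(2) by (rule LIMSEQ_unique[rotated])
    then show "l \<in> emb (l2 H) ` at_head ` carrier H" using x by blast
  qed
  then show "closedin (htopology (l2 H)) (at_head ` carrier H)"
    using Y.closed_emb_image[OF sub Y.complete] by simp
qed (simp_all add: at_head_add at_head_smult hnorm_at_head)

text \<open>
An element of \<open>X\<close> is \<open>push x 0 + 0\<close>; if it is also \<open>push a g + g\<close> with \<open>a\<close> in the domain of \<open>A\<close>, then
injectivity of this parametrization forces \<open>x = a\<close>.
\<close>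

lemma outer_extension_dilation: "outer_extension H DA A at_head (l2 H) dilation_dom dilation"
proof -
  have at_head_eq: "at_head x = push x \<zero>\<^bsub>l2 H\<^esub> \<oplus>\<^bsub>l2 H\<^esub> \<zero>\<^bsub>l2 H\<^esub>" if "x \<in> carrier H" for x
    using at_head_in[OF that] by (simp add: at_head_def)
  have mem: "at_head a \<in> dilation_dom" and val: "dilation (at_head a) = at_head (A a)" if "a \<in> DA" for a
  proof -
    have "dilation (at_head a) = at_head (A a) \<ominus>\<^bsub>l2 H\<^esub> \<zero>\<^bsub>l2 H\<^esub>"
      using dilation_eq(2)[OF that defect_seqs_zero] at_head_eq[OF DA_in[OF that]] by (simp add: at_head_def)
    then show "dilation (at_head a) = at_head (A a)" using at_head_in[OF A_in[OF that]] by (simp add: Y.minus_eq)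
    show "at_head a \<in> dilation_dom" using dilation_eq(1)[OF that defect_seqs_zero] at_head_eq[OF DA_in[OF that]] by simp
  qed
  have "dilation_dom \<inter> at_head ` carrier H \<subseteq> at_head ` DA"
  proof
    fix y assume "y \<in> dilation_dom \<inter> at_head ` carrier H"
    then obtain x where y: "y \<in> dilation_dom" and x: "x \<in> carrier H" "y = at_head x" by blast
    obtain a g where ag: "a \<in> DA" "g \<in> defect_seqs" "y = push a g \<oplus>\<^bsub>l2 H\<^esub> g" using y by (rule dilation_dom_cases)
    have "push a g \<oplus>\<^bsub>l2 H\<^esub> g = push x \<zero>\<^bsub>l2 H\<^esub> \<oplus>\<^bsub>l2 H\<^esub> \<zero>\<^bsub>l2 H\<^esub>"
      using ag(3) x at_head_eq[OF x(1)] by simp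
    from push_add_inject(1)[OF DA_in[OF ag(1)] x(1) defect_seqs_in[OF ag(2)] Y.zero_closed this]
    show "y \<in> at_head ` DA" using ag(1) x(2) by simp
  qed
  then have "at_head ` DA = dilation_dom \<inter> at_head ` carrier H" using mem DA_in by blast
  then show ?thesis using linear_dilation val by (simp add: outer_extension_def)
qed

end

theorem theorem7p1:
  fixes X :: "'a hilbert" and DA :: "'a set" and A :: "'a \<Rightarrow> 'a"
  assumes "complex_hilbert_space X"
    and "linear_operator X DA A"
    and "closed_operator X DA A"
    and "densely_defined X DA"
    and "dissipative X DA A"
    and "\<exists>\<mu>::complex. Re \<mu> < 0 \<and> \<mu> \<notin> point_spectrum X DA A"
  shows "\<exists>(Y :: (nat \<Rightarrow> 'a) hilbert) \<iota> DB B.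
    complex_hilbert_space Y \<and>
    isometric_embedding X Y \<iota> \<and>
    outer_extension X DA A \<iota> Y DB B \<and>
    generates_contraction_semigroup Y DB B"
proof -
  interpret closed_dissipative_operator X DA A
    using assms by (intro closed_dissipative_operator.intro closed_dissipative_operator_axioms.intro)
  show ?thesis
    using Y.complex_hilbert_space_axioms isometric_embedding_at_head outer_extension_dilation dilation_generates by blast
qed

end
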